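(* Let $d\in\mathbb N$, $p>2$, let $\Omega\subset\mathbb R^d$ be a bounded open domain with the uniform exterior ball condition (see context), let $f\in C(\overline\Omega)$, and let $g$ be a bounded continuous function on $\mathbb R^d\setminus\Omega$. Let $m(\varepsilon)=\varepsilon^{\frac{2}{2+\alpha}}$, $M(\varepsilon)=\varepsilon^{-\frac{2}{2-\alpha}}$ with $\alpha=\frac{p-2}{p-1}$, and let $\varepsilon\in(0,1)$. Consider the two-player zero-sum game described in the context. Then the game has a value, and it is given by the unique bounded Borel solution $u_\varepsilon$ of the dynamic programming principle $$\begin{cases}u_\varepsilon(x)=\mathcal A_\varepsilon[u_\varepsilon;f](x)-\varepsilon^2J_p(f(x)) & \text{if }x\in\Omega,\\ u_\varepsilon(x)=g(x)&\text{if }x\in\mathbb R^d\setminus\Omega,\end{cases}$$ where $\mathcal A_\varepsilon[\varphi;f](x)=\mathcal A^+_\varepsilon[\varphi](x)$ if $f(x)\ge0$ and $\mathcal A_\varepsilon[\varphi;f](x)=\mathcal A^-_\varepsilon[\varphi](x)$ if $f(x)<0$. That is, $u_\varepsilon(x)=u^\varepsilon_I(x)=u^\varepsilon_{II}(x)$ for all $x\in\mathbb R^d$, where $u^\varepsilon_I$ and $u^\varepsilon_{II}$ are the values of the game for Player I and Player II.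
   Context: Uniform exterior ball condition: there exists $R>0$ such that for all $x_0\in\partial\Omega$ there exists $z_0\in\mathbb R^d\setminus\Omega$ with $\overline{B_R(z_0)}\cap\overline\Omega=\{x_0\}$. Constants and operators: $\alpha=\frac{p-2}{p-1}$, $\beta=\frac{p-2}{p+d}$, $\gamma=\sqrt{2(p+d)}$. $B_r(x)$ is the ball of radius $r$ centred at $x$. $J_p(\xi)=\xi^{\frac1{p-1}}$ for $\xi\ge0$ and $J_p(\xi)=-(-\xi)^{\frac1{p-1}}$ for $\xi\le 0$. For bounded Borel $\varphi:\mathbb R^d\to\mathbb R$: $$\mathcal M_r[\varphi](x)=\beta\Big(\tfrac12\sup_{B_{\gamma r}(x)}\varphi+\tfrac12\inf_{B_{\gamma r}(x)}\varphi\Big)+(1-\beta)\frac{1}{|B_{\gamma r}(x)|}\int_{B_{\gamma r}(x)}\varphi(y)\,dy ,$$ $$\mathcal A^+_\varepsilon[\varphi](x)=\inf_{c\in[m(\varepsilon),M(\varepsilon)]}\Big\{\alpha\sup_{B_{\varepsilon^2c^{1-\alpha}}(x)}\varphi+(1-\alpha)\mathcal M_{\varepsilon c^{-\alpha/2}}[\varphi](x)\Big\},$$ $$\mathcal A^-_\varepsilon[\varphi](x)=\sup_{c\in[m(\varepsilon),M(\varepsilon)]}\Big\{\alpha\inf_{B_{\varepsilon^2c^{1-\alpha}}(x)}\varphi+(1-\alpha)\mathcal M_{\varepsilon c^{-\alpha/2}}[\varphi](x)\Big\}.$$ The game. The game starts at a point $x_0$. The first player (Player I) wants to maximize and the second player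 (Player II) wants to minimize the final payoff. At each turn, with current position $x\in\Omega$: - if $f(x)\ge0$, Player II chooses a constant $c\in[m(\varepsilon),M(\varepsilon)]$. Then a biased coin with probability $\alpha$ of heads and $1-\alpha$ of tails is tossed. If heads, Player I chooses the next position at any point of $B_{\varepsilon^2c^{1-\alpha}}(x)$. If tails, a round of tug-of-war with noise is played in $B_{\gamma\varepsilon c^{-\alpha/2}}(x)$: with probability $\beta$ a fair coin decides which of the two players chooses the next position inside this ball, and with probability $1-\beta$ the next position is chosen at random (uniformly) in this ball; - if $f(x)<0$ the roles of the players are reversed: Player I chooses $c$, and if the first toss gives heads Player II chooses the next position in $B_{\varepsilon^2c^{1-\alpha}}(x)$. This is repeated, with a running payoff $-\varepsilon^2J_p(f(x))$ at each movement, until the position lies outside $\Omega$ for the first time; this position is denoted $x_\tau$, and then Player II pays $g(x_\tau)$ to Player I. Strategies and values. A strategy $S_I$ for Player I (resp. $S_{II}$ for Player II) is a function defined on the partial histories of the game that specifies the choices that player will make: the constant $c\in[m(\varepsilon),M(\varepsilon)]$ when that player is the one who chooses it, and the next position of the game (in the corresponding ball, which is determined by the $c$ already chosen in that turn) whenever that player is the one who chooses it. When both strategies are fixed, $\mathbb E^{x_0}_{S_I,S_{II}}$ denotes expectation with respect to the probability measure on game histories starting at $x_0$ obtained from Kolmogorov's extension theorem; the game ends almost surely regardless of the strategies. The values of the game for Player I and Player II are $$u^\varepsilon_I(x_0)=\sup_{S_I}\inf_{S_{II}}\mathbb E^{x_0}_{S_I,S_{II}}\Big[-\varepsilon^2\sum_{i=0}^{\tau-1}J_p(f(x_i))+g(x_\tau)\Big],\qquad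 u^\varepsilon_{II}(x_0)=\inf_{S_{II}}\sup_{S_I}\mathbb E^{x_0}_{S_I,S_{II}}\Big[-\varepsilon^2\sum_{i=0}^{\tau-1}J_p(f(x_i))+g(x_\tau)\Big].$$ The game has a value if $u^\varepsilon_I=u^\varepsilon_{II}$. *)

theory Defs
  imports "HOL-Probability.Probability"
begin

section \<open>Constants, operators and the dynamic programming principle\<close>

definition alpha :: "real \<Rightarrow> real" where
  "alpha p = (p - 2) / (p - 1)"

definition beta :: "real \<Rightarrow> nat \<Rightarrow> real" where
  "beta p d = (p - 2) / (p + real d)"

definition gamma :: "real \<Rightarrow> nat \<Rightarrow> real" where
  "gamma p d = sqrt (2 * (p + real d))"

definition c_min :: "real \<Rightarrow> real \<Rightarrow> real" where
  "c_min p \<epsilon> = \<epsilon> powr (2 / (2 + alpha p))"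

definition c_max :: "real \<Rightarrow> real \<Rightarrow> real" where
  "c_max p \<epsilon> = \<epsilon> powr (- (2 / (2 - alpha p)))"

definition J :: "real \<Rightarrow> real \<Rightarrow> real" where
  "J p \<xi> = (if \<xi> \<ge> 0 then \<xi> powr (1 / (p - 1)) else - ((- \<xi>) powr (1 / (p - 1))))"

definition uniform_exterior_ball :: "'a::euclidean_space set \<Rightarrow> bool" where
  "uniform_exterior_ball \<Omega> \<longleftrightarrow>
    (\<exists>R>0. \<forall>x0\<in>frontier \<Omega>. \<exists>z0. z0 \<notin> \<Omega> \<and> closure (ball z0 R) \<inter> closure \<Omega> = {x0})"

definition mean_op :: "real \<Rightarrow> real \<Rightarrow> ('a::euclidean_space \<Rightarrow> real) \<Rightarrow> 'a \<Rightarrow> real" where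
  "mean_op p r \<phi> x =
    (let b = beta p DIM('a); B = ball x (gamma p DIM('a) * r) in
      b * (1 / 2 * (SUP y\<in>B. \<phi> y) + 1 / 2 * (INF y\<in>B. \<phi> y))
      + (1 - b) * (1 / measure lborel B * (LINT y:B|lborel. \<phi> y)))"

definition A_plus :: "real \<Rightarrow> real \<Rightarrow> ('a::euclidean_space \<Rightarrow> real) \<Rightarrow> 'a \<Rightarrow> real" where
  "A_plus p \<epsilon> \<phi> x =
    (INF c\<in>{c_min p \<epsilon>..c_max p \<epsilon>}.
      alpha p * (SUP y\<in>ball x (\<epsilon>\<^sup>2 * c powr (1 - alpha p)). \<phi> y)
      + (1 - alpha p) * mean_op p (\<epsilon> * c powr (- (alpha p / 2))) \<phi> x)"

definition A_minus :: "real \<Rightarrow> real \<Rightarrow> ('a::euclidean_space \<Rightarrow> real) \<Rightarrow> 'a \<Rightarrow> real" where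
  "A_minus p \<epsilon> \<phi> x =
    (SUP c\<in>{c_min p \<epsilon>..c_max p \<epsilon>}.
      alpha p * (INF y\<in>ball x (\<epsilon>\<^sup>2 * c powr (1 - alpha p)). \<phi> y)
      + (1 - alpha p) * mean_op p (\<epsilon> * c powr (- (alpha p / 2))) \<phi> x)"

definition A_op ::
  "real \<Rightarrow> real \<Rightarrow> ('a::euclidean_space \<Rightarrow> real) \<Rightarrow> ('a \<Rightarrow> real) \<Rightarrow> 'a \<Rightarrow> real" where
  "A_op p \<epsilon> f \<phi> x = (if f x \<ge> 0 then A_plus p \<epsilon> \<phi> x else A_minus p \<epsilon> \<phi> x)"

definition bounded_borel_dpp_solution ::
  "real \<Rightarrow> real \<Rightarrow> 'a::euclidean_space set \<Rightarrow> ('a \<Rightarrow> real) \<Rightarrow> ('a \<Rightarrow> real) \<Rightarrow> ('a \<Rightarrow> real) \<Rightarrow> bool" where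
  "bounded_borel_dpp_solution p \<epsilon> \<Omega> f g u \<longleftrightarrow>
    u \<in> borel_measurable borel \<and> bounded (range u) \<and>
    (\<forall>x\<in>\<Omega>. u x = A_op p \<epsilon> f u x - \<epsilon>\<^sup>2 * J p (f x)) \<and>
    (\<forall>x. x \<notin> \<Omega> \<longrightarrow> u x = g x)"

section \<open>The game\<close>

text \<open>Result of the coin tosses of one turn: heads of the biased coin; tails, followed by a round
  of tug-of-war whose fair coin is won by Player I resp. Player II; tails, followed by a random
  move.\<close>

datatype toss = Heads | TugI | TugII | Noise

definition toss_pmf :: "real \<Rightarrow> nat \<Rightarrow> toss pmf" where
  "toss_pmf p d =
    do {
      heads \<leftarrow> bernoulli_pmf (alpha p);
      if heads then return_pmf Heads
      else do {
        tug \<leftarrow> bernoulli_pmf (beta p d);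
        if tug then map_pmf (\<lambda>b. if b then TugI else TugII) (bernoulli_pmf (1 / 2))
        else return_pmf Noise
      }
    }"

text \<open>A turn records the chosen constant, the result of the tosses and the next position. A history
  consists of the starting point \<open>x\<^sub>0\<close> and a sequence of turns; after \<open>n\<close> turns, only the
  turns with index below \<open>n\<close> are present, and the current position is \<open>x\<^sub>n\<close>.\<close>

type_synonym 'a turn = "real \<times> toss \<times> 'a"
type_synonym 'a history = "'a \<times> (nat \<Rightarrow> 'a turn)"

definition turn_space :: "'a::euclidean_space turn measure" where
  "turn_space = borel \<Otimes>\<^sub>M count_space UNIV \<Otimes>\<^sub>M borel"

definition history_space :: "nat \<Rightarrow> 'a::euclidean_space history measure" where
  "history_space n = borel \<Otimes>\<^sub>M (\<Pi>\<^sub>M i\<in>{0..<n}. turn_space)"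

definition position :: "nat \<Rightarrow> 'a history \<Rightarrow> 'a" where
  "position n h = (case n of 0 \<Rightarrow> fst h | Suc k \<Rightarrow> snd (snd (snd h k)))"

text \<open>The two functions that pick a position also see the constant chosen in the current turn:
  \<open>heads_move\<close> is used when the biased coin shows heads and this player moves, \<open>tug_move\<close>
  when this player wins the fair coin of the tug-of-war round.\<close>

record 'a strategy =
  const :: "nat \<Rightarrow> 'a history \<Rightarrow> real"
  heads_move :: "nat \<Rightarrow> 'a history \<Rightarrow> real \<Rightarrow> 'a"
  tug_move :: "nat \<Rightarrow> 'a history \<Rightarrow> real \<Rightarrow> 'a"

text \<open>\<open>picks x\<close> says that the player chooses the constant at the position \<open>x\<close>; the
  opponent then moves on heads. Borel measurability is what makes the law of the game well defined.\<close>

definition admissible ::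
  "real \<Rightarrow> real \<Rightarrow> 'a::euclidean_space set \<Rightarrow> ('a \<Rightarrow> bool) \<Rightarrow> 'a strategy \<Rightarrow> bool" where
  "admissible p \<epsilon> \<Omega> picks S \<longleftrightarrow>
    (\<forall>n. const S n \<in> borel_measurable (history_space n)) \<and>
    (\<forall>n. case_prod (heads_move S n) \<in> borel_measurable (history_space n \<Otimes>\<^sub>M borel)) \<and>
    (\<forall>n. case_prod (tug_move S n) \<in> borel_measurable (history_space n \<Otimes>\<^sub>M borel)) \<and>
    (\<forall>n. \<forall>h\<in>space (history_space n). position n h \<in> \<Omega> \<longrightarrow>
      (picks (position n h) \<longrightarrow> const S n h \<in> {c_min p \<epsilon>..c_max p \<epsilon>}) \<and>
      (\<forall>c\<in>{c_min p \<epsilon>..c_max p \<epsilon>}.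
        (\<not> picks (position n h) \<longrightarrow>
          heads_move S n h c \<in> ball (position n h) (\<epsilon>\<^sup>2 * c powr (1 - alpha p))) \<and>
        tug_move S n h c
          \<in> ball (position n h) (gamma p DIM('a) * \<epsilon> * c powr (- (alpha p / 2)))))"

definition strategies_I ::
  "real \<Rightarrow> real \<Rightarrow> 'a::euclidean_space set \<Rightarrow> ('a \<Rightarrow> real) \<Rightarrow> 'a strategy set" where
  "strategies_I p \<epsilon> \<Omega> f = {S. admissible p \<epsilon> \<Omega> (\<lambda>x. f x < 0) S}"

definition strategies_II ::
  "real \<Rightarrow> real \<Rightarrow> 'a::euclidean_space set \<Rightarrow> ('a \<Rightarrow> real) \<Rightarrow> 'a strategy set" where
  "strategies_II p \<epsilon> \<Omega> f = {S. admissible p \<epsilon> \<Omega> (\<lambda>x. f x \<ge> 0) S}"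

text \<open>Law of the turn that follows the partial history \<open>h\<close> of length \<open>n\<close>. Outside
  \<open>\<Omega>\<close> the game is over; the position is then frozen so that histories are infinite.\<close>

definition turn_law ::
  "real \<Rightarrow> real \<Rightarrow> 'a::euclidean_space set \<Rightarrow> ('a \<Rightarrow> real) \<Rightarrow> 'a strategy \<Rightarrow> 'a strategy \<Rightarrow>
    nat \<Rightarrow> 'a history \<Rightarrow> 'a turn measure" where
  "turn_law p \<epsilon> \<Omega> f S_I S_II n h =
    (let x = position n h in
      if x \<in> \<Omega> then
        (let c = (if f x \<ge> 0 then const S_II n h else const S_I n h);
             next_position = (\<lambda>t. case t of
               Heads \<Rightarrow>
                 return borel (if f x \<ge> 0 then heads_move S_I n h c else heads_move S_II n h c)
             | TugI \<Rightarrow> return borel (tug_move S_I n h c)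
             | TugII \<Rightarrow> return borel (tug_move S_II n h c)
             | Noise \<Rightarrow>
                 uniform_measure lborel
                   (ball x (gamma p DIM('a) * \<epsilon> * c powr (- (alpha p / 2)))))
         in measure_pmf (toss_pmf p DIM('a)) \<bind>
              (\<lambda>t. distr (next_position t) turn_space (\<lambda>y. (c, t, y))))
      else return turn_space (0, Noise, x))"

text \<open>The probability measure on infinite sequences of turns, by the extension theorem applied to
  the finite-dimensional distributions generated by the transition laws.\<close>

definition game_measure ::
  "real \<Rightarrow> real \<Rightarrow> 'a::euclidean_space set \<Rightarrow> ('a \<Rightarrow> real) \<Rightarrow> 'a strategy \<Rightarrow> 'a strategy \<Rightarrow>
    'a \<Rightarrow> (nat \<Rightarrow> 'a turn) measure" where
  "game_measure p \<epsilon> \<Omega> f S_I S_II x0 =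
    projective_family.lim UNIV
      (Ionescu_Tulcea.CI (\<lambda>n \<omega>. turn_law p \<epsilon> \<Omega> f S_I S_II n (x0, \<omega>)) (\<lambda>_. turn_space))
      (\<lambda>_. turn_space)"

definition exit_time :: "'a set \<Rightarrow> 'a history \<Rightarrow> nat" where
  "exit_time \<Omega> h = (LEAST n. position n h \<notin> \<Omega>)"

text \<open>Histories that never leave \<open>\<Omega>\<close> have probability zero; the value \<open>0\<close> there is
  arbitrary.\<close>

definition payoff ::
  "real \<Rightarrow> real \<Rightarrow> 'a set \<Rightarrow> ('a \<Rightarrow> real) \<Rightarrow> ('a \<Rightarrow> real) \<Rightarrow> 'a history \<Rightarrow> real" where
  "payoff p \<epsilon> \<Omega> f g h =
    (if \<exists>n. position n h \<notin> \<Omega>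
     then - \<epsilon>\<^sup>2 * (\<Sum>i<exit_time \<Omega> h. J p (f (position i h))) + g (position (exit_time \<Omega> h) h)
     else 0)"

definition expected_payoff ::
  "real \<Rightarrow> real \<Rightarrow> 'a::euclidean_space set \<Rightarrow> ('a \<Rightarrow> real) \<Rightarrow> ('a \<Rightarrow> real) \<Rightarrow>
    'a strategy \<Rightarrow> 'a strategy \<Rightarrow> 'a \<Rightarrow> real" where
  "expected_payoff p \<epsilon> \<Omega> f g S_I S_II x0 =
    (LINT \<omega>|game_measure p \<epsilon> \<Omega> f S_I S_II x0. payoff p \<epsilon> \<Omega> f g (x0, \<omega>))"

definition value_I ::
  "real \<Rightarrow> real \<Rightarrow> 'a::euclidean_space set \<Rightarrow> ('a \<Rightarrow> real) \<Rightarrow> ('a \<Rightarrow> real) \<Rightarrow> 'a \<Rightarrow> real" where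
  "value_I p \<epsilon> \<Omega> f g x0 =
    (SUP S_I\<in>strategies_I p \<epsilon> \<Omega> f. INF S_II\<in>strategies_II p \<epsilon> \<Omega> f.
      expected_payoff p \<epsilon> \<Omega> f g S_I S_II x0)"

definition value_II ::
  "real \<Rightarrow> real \<Rightarrow> 'a::euclidean_space set \<Rightarrow> ('a \<Rightarrow> real) \<Rightarrow> ('a \<Rightarrow> real) \<Rightarrow> 'a \<Rightarrow> real" where
  "value_II p \<epsilon> \<Omega> f g x0 =
    (INF S_II\<in>strategies_II p \<epsilon> \<Omega> f. SUP S_I\<in>strategies_I p \<epsilon> \<Omega> f.
      expected_payoff p \<epsilon> \<Omega> f g S_I S_II x0)"

end

theory Submission
  imports Defs
begin

text \<open>A solution \<open>u\<close> of the dynamic programming principle is the value of the game because it is a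
  martingale up to the running payoff when both players move optimally: a player who always picks a
  near-optimal constant and near-optimal positions for \<open>u\<close> makes \<open>u\<close> of the position, corrected by the
  accumulated running payoff, a submartingale (Player I) or a supermartingale (Player II) up to a
  small error per turn, against every strategy of the opponent. Summing over the turns compares the
  expected payoff with \<open>u\<close> of the starting point (\<open>expected_payoff_le\<close>, \<open>solution_eq_value\<close>). This
  also gives uniqueness, since the value does not depend on the solution. Three difficulties remain.

  \<^bold>\<open>Duration.\<close> The errors must be summable and the game must end. Every turn has probability at
  least \<open>\<kappa> = (1 - \<alpha>) (1 - \<beta>) > 0\<close> of a uniform move in a ball whose radius is bounded below, and such
  a move has a fixed chance of a definite advance in a fixed direction. A truncated exponential in that
  direction therefore yields a bounded function \<open>\<psi>\<close> that decreases by at least 1 in expectation at every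
  turn inside the domain, even if all moves made by the players lead to a point where \<open>\<psi>\<close> is
  maximal (\<open>lyapunov_exists\<close>). Hence any upper bound of \<open>\<psi>\<close> bounds the expected duration, for all strategies
  (\<open>expected_duration\<close>).

  \<^bold>\<open>Existence.\<close> The operator of the dynamic programming principle does not commute with monotone
  pointwise limits, so iteration needs uniform convergence. The same \<open>\<psi>\<close> provides it: in the norm
  weighted by \<open>\<psi>\<close> the operator is a contraction (\<open>dpp_contraction\<close>), and its iterates
  converge uniformly to a bounded Borel fixed point (\<open>solution_exists\<close>).

  \<^bold>\<open>Measurability.\<close> The operator contains an infimum over an uncountable set of constants \<open>c\<close>, and
  strategies have to be Borel. The bracket that is minimized is a sum of a lower semicontinuous
  function (suprema over open balls), an upper semicontinuous one (infima) and a continuous one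
  (averages), jointly in the position and \<open>c\<close>. It is in general not semicontinuous itself, but its
  strict sublevel sets are \<open>F\<^sub>\<sigma>\<close>, hence countable unions of compact sets, and projections of compact
  sets are compact. So the infimum is Borel, and minimal points of compact sections give Borel
  near-minimizers (\<open>borel_measurable_section_INF\<close>, \<open>borel_near_minimizer_section\<close>).\<close>

section \<open>Borel infima and near-optimal Borel selections\<close>

text \<open>A common weakening of lower and upper semicontinuity on a closed set. It is stable under addition,
  so it applies to the sum of a lower and an upper semicontinuous function.\<close>

definition fsigma_sublevels :: "'a::euclidean_space set \<Rightarrow> ('a \<Rightarrow> real) \<Rightarrow> bool" where
  "fsigma_sublevels X G \<longleftrightarrow> (\<forall>a. fsigma_in euclidean {z \<in> X. G z < a})"

lemma fsigma_sublevels_usc: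
  assumes "closed X" and "\<And>a. openin (top_of_set X) {z \<in> X. G z < a}"
  shows "fsigma_sublevels X G"
  unfolding fsigma_sublevels_def
proof
  fix a
  obtain T where T: "open T" "{z \<in> X. G z < a} = T \<inter> X"
    using assms(2)[of a] by (auto simp: openin_open)
  have "fsigma_in euclidean T"
    using T(1) open_imp_fsigma_in[OF metrizable_space_euclidean] by auto
  moreover have "fsigma_in euclidean X"
    using assms(1) by (intro closed_imp_fsigma_in) auto
  ultimately show "fsigma_in euclidean {z \<in> X. G z < a}"
    unfolding T(2) by (rule fsigma_in_Int)
qed

text \<open>A strict sublevel set of a lower semicontinuous function is the union of the closed sets
  \<open>{G \<le> q}\<close> over the rationals below the level.\<close>

lemma fsigma_sublevels_lsc:
  assumes "closed X" and "\<And>a. openin (top_of_set X) {z \<in> X. G z > a}"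
  shows "fsigma_sublevels X G"
  unfolding fsigma_sublevels_def
proof
  fix a
  have eq: "{z \<in> X. G z < a} = (\<Union>q\<in>{q\<in>\<rat>. q < a}. {z \<in> X. G z \<le> q})"
  proof (intro subset_antisym subsetI)
    fix z assume "z \<in> {z \<in> X. G z < a}"
    moreover from this obtain q where "q \<in> \<rat>" "G z < q" "q < a"
      using Rats_dense_in_real by blast
    ultimately show "z \<in> (\<Union>q\<in>{q\<in>\<rat>. q < a}. {z \<in> X. G z \<le> q})"
      by force
  qed auto
  have "closed {z \<in> X. G z \<le> q}" for q
  proof -
    have "{z \<in> X. G z \<le> q} = X - {z \<in> X. G z > q}" by auto
    then have "closedin (top_of_set X) {z \<in> X. G z \<le> q}"
      using assms(2)[of q] by (simp add: closedin_def Diff_Diff_Int Int_absorb1 Collect_mono)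
    then show ?thesis using assms(1) closedin_closed_trans by blast
  qed
  then show "fsigma_in euclidean {z \<in> X. G z < a}"
    unfolding eq
    by (intro fsigma_in_Union) (auto intro!: closed_imp_fsigma_in countable_image
      intro: countable_subset[OF _ countable_rat])
qed

lemma fsigma_sublevels_add:
  assumes "fsigma_sublevels X F" and "fsigma_sublevels X G"
  shows "fsigma_sublevels X (\<lambda>z. F z + G z)"
  unfolding fsigma_sublevels_def
proof
  fix a
  have eq: "{z \<in> X. F z + G z < a} = (\<Union>q\<in>\<rat>. {z \<in> X. F z < q} \<inter> {z \<in> X. G z < a - q})"
  proof (intro subset_antisym subsetI)
    fix z assume z: "z \<in> {z \<in> X. F z + G z < a}"
    then have "F z < a - G z" by auto
    then obtain q where "q \<in> \<rat>" "F z < q" "q < a - G z"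
      using Rats_dense_in_real by blast
    with z show "z \<in> (\<Union>q\<in>\<rat>. {z \<in> X. F z < q} \<inter> {z \<in> X. G z < a - q})"
      by force
  qed auto
  show "fsigma_in euclidean {z \<in> X. F z + G z < a}"
    unfolding eq using assms
    by (intro fsigma_in_Union)
       (auto simp: fsigma_sublevels_def intro!: fsigma_in_Int countable_image countable_rat)
qed

lemma fsigma_sublevels_scale:
  assumes "closed X" and "fsigma_sublevels X G" and "0 \<le> k"
  shows "fsigma_sublevels X (\<lambda>z. k * G z)"
  unfolding fsigma_sublevels_def
proof
  fix a
  show "fsigma_in euclidean {z \<in> X. k * G z < a}"
  proof (cases "k = 0")
    case True
    then show ?thesis using assms(1)
      by (cases "0 < a") (auto intro!: closed_imp_fsigma_in)
  next
    case False
    then have "{z \<in> X. k * G z < a} = {z \<in> X. G z < a / k}"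
      using assms(3) by (auto simp: field_simps)
    then show ?thesis using assms(2) by (auto simp: fsigma_sublevels_def)
  qed
qed

lemma fsigma_in_compacts:
  fixes S :: "'a::euclidean_space set"
  assumes "fsigma_in euclidean S"
  shows "\<exists>K :: nat \<Rightarrow> 'a set. (\<forall>n. compact (K n)) \<and> S = (\<Union>n. K n)"
proof -
  obtain C where "(\<forall>n. closedin euclidean (C n)) \<and> (\<forall>n. C n \<subseteq> C (Suc n)) \<and> \<Union> (range C) = S"
    using assms unfolding fsigma_in_ascending by blast
  then have "fsigma S" using fsigma.intros[of C] by auto
  then obtain F :: "nat \<Rightarrow> 'a set" where "range F \<subseteq> Collect compact" "S = (\<Union>n. F n)"
    unfolding fsigma_Union_compact by blast
  then show ?thesis by (intro exI[of _ F]) auto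
qed

text \<open>The lowest point of the section of a compact set is a Borel function of the base point, because its
  sublevel sets are again projections of compact sets. The value \<open>m\<close> is a default outside the
  projection.\<close>

lemma borel_measurable_lowest_point:
  fixes K :: "('a::euclidean_space \<times> real) set" and m :: real
  assumes K: "compact K"
  defines "s \<equiv> \<lambda>x. if x \<in> fst ` K then Inf {c. (x, c) \<in> K} else m"
  shows "s \<in> borel_measurable borel" and "\<And>x. x \<in> fst ` K \<Longrightarrow> (x, s x) \<in> K"
proof -
  have cK: "closed K" using K by (rule compact_imp_closed)
  have sec: "closed {c. (x, c) \<in> K}" "bdd_below {c. (x, c) \<in> K}" for x
  proof -
    have "{c. (x, c) \<in> K} = Pair x -` K" by auto
    then show "closed {c. (x, c) \<in> K}"
      by (simp add: continuous_closed_vimage[OF cK] continuous_intros)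
    have "bounded (snd ` K)" using K by (simp add: bounded_snd compact_imp_bounded)
    moreover have "{c. (x, c) \<in> K} \<subseteq> snd ` K" by force
    ultimately show "bdd_below {c. (x, c) \<in> K}"
      by (intro bounded_imp_bdd_below) (rule bounded_subset)
  qed
  show att: "(x, s x) \<in> K" if x: "x \<in> fst ` K" for x
  proof -
    have "{c. (x, c) \<in> K} \<noteq> {}" using x by auto
    from closed_contains_Inf[OF this sec(2,1)] show ?thesis using x by (simp add: s_def)
  qed
  have P: "fst ` K \<in> sets borel"
    by (intro borel_closed compact_imp_closed compact_continuous_image continuous_intros K)
  have "{x. s x \<le> a} \<in> sets borel" for a
  proof -
    have "{x. s x \<le> a} = fst ` (K \<inter> UNIV \<times> {..a}) \<union> (if m \<le> a then - fst ` K else {})"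
    proof (intro set_eqI)
      fix x
      show "x \<in> {x. s x \<le> a} \<longleftrightarrow>
        x \<in> fst ` (K \<inter> UNIV \<times> {..a}) \<union> (if m \<le> a then - fst ` K else {})"
      proof (cases "x \<in> fst ` K")
        case True
        have "s x \<le> a \<longleftrightarrow> (\<exists>c\<le>a. (x, c) \<in> K)"
          using att[OF True] True cInf_lower[OF _ sec(2), of _ x]
          by (auto simp: s_def intro: order_trans)
        with True show ?thesis by force
      next
        case False
        then show ?thesis by (auto simp: s_def)
      qed
    qed
    moreover have "compact (K \<inter> UNIV \<times> {..a})"
      by (rule compact_Int_closed[OF K]) (auto intro: closed_Times)
    then have "fst ` (K \<inter> UNIV \<times> {..a}) \<in> sets borel"
      by (intro borel_closed compact_imp_closed compact_continuous_image continuous_intros)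
    ultimately show ?thesis using P by auto
  qed
  then show "s \<in> borel_measurable borel"
    by (simp add: borel_measurable_iff_le)
qed

text \<open>The infimum is below \<open>a\<close> exactly on the projection of the strict sublevel set of \<open>G\<close>. Projections of
  Borel sets need not be Borel; here the sublevel set is a countable union of compact sets and its
  projection is one, too.\<close>

lemma borel_measurable_section_INF:
  fixes G :: "'a::euclidean_space \<times> real \<Rightarrow> real"
  assumes G: "fsigma_sublevels (UNIV \<times> {m..M}) G" and "m \<le> M"
    and bdd: "\<And>x. bdd_below ((\<lambda>c. G (x, c)) ` {m..M})"
  shows "(\<lambda>x. INF c\<in>{m..M}. G (x, c)) \<in> borel_measurable borel"
proof -
  have "{x. (INF c\<in>{m..M}. G (x, c)) < a} \<in> sets borel" for a
  proof -
    obtain K where K: "\<And>n. compact (K n)" "{z \<in> UNIV \<times> {m..M}. G z < a} = (\<Union>n::nat. K n)"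
      using G fsigma_in_compacts[of "{z \<in> UNIV \<times> {m..M}. G z < a}"]
      unfolding fsigma_sublevels_def by blast
    have "{x. (INF c\<in>{m..M}. G (x, c)) < a} = fst ` {z \<in> UNIV \<times> {m..M}. G z < a}"
      using \<open>m \<le> M\<close> by (auto simp: cINF_less_iff[OF _ bdd] image_iff)
    also have "\<dots> = (\<Union>n. fst ` K n)" unfolding K(2) by auto
    also have "\<dots> \<in> sets borel"
      by (intro sets.countable_UN)
        (auto intro!: borel_closed compact_imp_closed compact_continuous_image continuous_intros K)
    finally show ?thesis .
  qed
  then show ?thesis by (simp add: borel_measurable_iff_less)
qed

text \<open>All strict sublevel sets with rational level are cut into countably many compact pieces. The
  near-minimizer at \<open>x\<close> is the lowest point above \<open>x\<close> of the first piece, in a fixed enumeration, that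
  lies over \<open>x\<close> and has a level below the infimum plus \<open>\<delta>\<close>.\<close>

lemma borel_near_minimizer_section:
  fixes G :: "'a::euclidean_space \<times> real \<Rightarrow> real"
  assumes G: "fsigma_sublevels (UNIV \<times> {m..M}) G" and "m \<le> M"
    and bdd: "\<And>x. bdd_below ((\<lambda>c. G (x, c)) ` {m..M})" and "0 < \<delta>"
  obtains s where "s \<in> borel_measurable borel" "\<And>x. s x \<in> {m..M}"
    "\<And>x. G (x, s x) < (INF c\<in>{m..M}. G (x, c)) + \<delta>"
proof -
  let ?v = "\<lambda>x. INF c\<in>{m..M}. G (x, c)"
  have v[measurable]: "?v \<in> borel_measurable borel"
    by (rule borel_measurable_section_INF[OF assms(1-3)])
  have "\<exists>K. (\<forall>n. compact (K n)) \<and> {z \<in> UNIV \<times> {m..M}. G z < a} = (\<Union>n::nat. K n)" for a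
    using G unfolding fsigma_sublevels_def by (intro fsigma_in_compacts) blast
  then obtain K where K: "\<And>a n. compact (K a n)"
    "\<And>a. {z \<in> UNIV \<times> {m..M}. G z < a} = (\<Union>n::nat. K a n)"
    by metis
  \<comment> \<open>index \<open>i\<close> encodes a rational level and the number of a compact piece of its sublevel set\<close>
  define lev where "lev i = real_of_rat (from_nat (fst (prod_decode i)))" for i
  define L where "L i = K (lev i) (snd (prod_decode i))" for i
  define s where "s i x = (if x \<in> fst ` L i then Inf {c. (x, c) \<in> L i} else m)" for i x
  have s: "s i \<in> borel_measurable borel" "x \<in> fst ` L i \<Longrightarrow> (x, s i x) \<in> L i" for i x
    using borel_measurable_lowest_point[where K = "L i" and m = m] K(1) by (auto simp: s_def[abs_def] L_def)
  have LG: "c \<in> {m..M} \<and> G (x, c) < lev i" if "(x, c) \<in> L i" for x c i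
  proof -
    have "(x, c) \<in> {z \<in> UNIV \<times> {m..M}. G z < lev i}"
      using that unfolding K(2) by (auto simp: L_def)
    then show ?thesis by auto
  qed
  define N where "N x = (LEAST i. x \<in> fst ` L i \<and> lev i < ?v x + \<delta>)" for x
  have "closed (fst ` L i)" for i
    by (auto intro!: compact_imp_closed compact_continuous_image continuous_intros simp: L_def K)
  then have [measurable]: "fst ` L i \<in> sets borel" for i by simp
  have N_meas[measurable]: "N \<in> measurable borel (count_space UNIV)"
    unfolding N_def by measurable
  have ex: "x \<in> fst ` L (N x) \<and> lev (N x) < ?v x + \<delta>" for x
  proof -
    obtain q where q: "q \<in> \<rat>" "?v x < q" "q < ?v x + \<delta>"
      using Rats_dense_in_real[of "?v x" "?v x + \<delta>"] \<open>0 < \<delta>\<close> by auto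
    then obtain c where "c \<in> {m..M}" "G (x, c) < q"
      using \<open>m \<le> M\<close> by (auto simp: cINF_less_iff[OF _ bdd])
    then have "(x, c) \<in> {z \<in> UNIV \<times> {m..M}. G z < q}" by auto
    then obtain n where n: "(x, c) \<in> K q n" unfolding K(2) by auto
    obtain r where r: "q = real_of_rat r" using q(1) Rats_cases by blast
    define i where "i = prod_encode (to_nat r, n)"
    have "lev i = q" "L i = K q n" by (auto simp: lev_def L_def i_def r)
    then have "x \<in> fst ` L i \<and> lev i < ?v x + \<delta>" using n q by force
    then show ?thesis unfolding N_def by (rule LeastI)
  qed
  show thesis
  proof (rule that)
    show "(\<lambda>x. s (N x) x) \<in> borel_measurable borel"
      by (rule measurable_compose_countable[OF _ N_meas]) (rule s(1))
    show "s (N x) x \<in> {m..M}" for x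
      using LG[OF s(2)[of x "N x"]] ex[of x] by auto
    show "G (x, s (N x) x) < ?v x + \<delta>" for x
      using LG[OF s(2)[of x "N x"]] ex[of x] by auto
  qed
qed

section \<open>Suprema, infima and averages over balls of variable centre and radius\<close>

text \<open>Lower semicontinuity of the supremum in centre and radius: a point \<open>y\<close> with \<open>\<phi> y > a\<close> in an open ball
  stays in the ball under small changes of centre and radius, whatever \<open>\<phi>\<close> is.\<close>

lemma openin_SUP_ball_greater:
  fixes \<xi> :: "'b::topological_space \<Rightarrow> 'a::euclidean_space"
  assumes "continuous_on X \<xi>" "continuous_on X \<rho>" "\<And>z. z \<in> X \<Longrightarrow> 0 < \<rho> z"
    and "bdd_above (range \<phi>)"
  shows "openin (top_of_set X) {z \<in> X. (SUP y\<in>ball (\<xi> z) (\<rho> z). \<phi> y) > (a::real)}"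
proof -
  have bdd: "bdd_above (\<phi> ` S)" for S
    using assms(4) by (rule bdd_above_mono) auto
  have "{z \<in> X. (SUP y\<in>ball (\<xi> z) (\<rho> z). \<phi> y) > a} =
    (\<Union>y\<in>{y. \<phi> y > a}. {z \<in> X. dist (\<xi> z) y - \<rho> z < 0})"
  proof (intro set_eqI)
    fix z
    have "(SUP y\<in>ball (\<xi> z) (\<rho> z). \<phi> y) > a \<longleftrightarrow> (\<exists>y\<in>ball (\<xi> z) (\<rho> z). \<phi> y > a)" if "z \<in> X"
      using assms(3)[OF that] by (intro less_cSUP_iff bdd) auto
    then show "z \<in> {z \<in> X. (SUP y\<in>ball (\<xi> z) (\<rho> z). \<phi> y) > a} \<longleftrightarrow>
      z \<in> (\<Union>y\<in>{y. \<phi> y > a}. {z \<in> X. dist (\<xi> z) y - \<rho> z < 0})"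
      by (simp add: Bex_def) blast
  qed
  moreover have "openin (top_of_set X) {z \<in> X. dist (\<xi> z) y - \<rho> z < 0}" for y
  proof -
    have "{z \<in> X. dist (\<xi> z) y - \<rho> z < 0} = X \<inter> (\<lambda>z. dist (\<xi> z) y - \<rho> z) -` {..<0}"
      by auto
    then show ?thesis
      by (simp only:) (intro continuous_openin_preimage_gen continuous_intros assms open_lessThan)
  qed
  ultimately show ?thesis by auto
qed

lemma SUP_uminus_real:
  fixes \<phi> :: "'a \<Rightarrow> real"
  shows "(SUP y\<in>S. - \<phi> y) = - (INF y\<in>S. \<phi> y)"
  by (simp add: Inf_real_def image_image)

lemma INF_uminus_real:
  fixes \<phi> :: "'a \<Rightarrow> real"
  shows "(INF y\<in>S. - \<phi> y) = - (SUP y\<in>S. \<phi> y)"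
  by (simp add: Inf_real_def image_image)

lemma openin_INF_ball_less:
  fixes \<xi> :: "'b::topological_space \<Rightarrow> 'a::euclidean_space"
  assumes "continuous_on X \<xi>" "continuous_on X \<rho>" "\<And>z. z \<in> X \<Longrightarrow> 0 < \<rho> z"
    and "bdd_below (range \<phi>)"
  shows "openin (top_of_set X) {z \<in> X. (INF y\<in>ball (\<xi> z) (\<rho> z). \<phi> y) < (a::real)}"
  using openin_SUP_ball_greater[of X \<xi> \<rho> "\<lambda>y. - \<phi> y" "- a"] assms
  by (simp add: SUP_uminus_real bdd_above_uminus[symmetric] image_image)

text \<open>The indicators of converging balls converge pointwise off the limit sphere, which is a null set.\<close>

lemma continuous_on_ball_integral:
  fixes \<phi> :: "'a::euclidean_space \<Rightarrow> real"
  assumes [measurable]: "\<phi> \<in> borel_measurable borel" and B: "\<And>y. \<bar>\<phi> y\<bar> \<le> B"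
  shows "continuous_on UNIV (\<lambda>(x, r). LINT y:ball x r|lborel. \<phi> y)"
proof (rule continuous_on_sequentiallyI)
  fix z :: "nat \<Rightarrow> 'a \<times> real" and w
  assume "z \<longlonglongrightarrow> w"
  obtain x r where w: "w = (x, r)" by (cases w)
  have lim: "z \<longlonglongrightarrow> (x, r)" using \<open>z \<longlonglongrightarrow> w\<close> w by simp
  have limx: "(\<lambda>n. fst (z n)) \<longlonglongrightarrow> x" and limr: "(\<lambda>n. snd (z n)) \<longlonglongrightarrow> r"
    using tendsto_fst[OF lim] tendsto_snd[OF lim] by auto
  obtain R where R: "\<And>n. norm (z n) \<le> R"
    using convergent_imp_bounded[OF lim] by (auto simp: bounded_iff)
  have sub: "ball (fst (z n)) (snd (z n)) \<subseteq> cball 0 (R + R)" for n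
  proof
    fix y assume "y \<in> ball (fst (z n)) (snd (z n))"
    then have "norm y \<le> norm (fst (z n)) + snd (z n)"
      by (simp add: dist_norm) (metis add.commute add_le_cancel_right diff_le_eq less_imp_le norm_minus_commute norm_triangle_ineq2 order_trans)
    also have "\<dots> \<le> R + R"
      using R[of n] norm_fst_le[of "fst (z n)" "snd (z n)"] norm_snd_le[of "snd (z n)" "fst (z n)"]
      by simp
    finally show "y \<in> cball 0 (R + R)" by simp
  qed
  have null: "sphere x r \<in> null_sets lborel"
    using negligible_sphere[of x r] by (simp add: null_sets_completion_iff negligible_iff_null_sets)
  have "(\<lambda>n. LINT y:ball (fst (z n)) (snd (z n))|lborel. \<phi> y) \<longlonglongrightarrow> (LINT y:ball x r|lborel. \<phi> y)"
    unfolding set_lebesgue_integral_def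
  proof (rule integral_dominated_convergence[where w = "\<lambda>y. B * indicator (cball 0 (R + R)) y"])
    show "integrable lborel (\<lambda>y. B * indicator (cball 0 (R + R)) y :: real)"
      by (intro integrable_mult_right integrable_real_indicator emeasure_lborel_cball_finite) auto
    show "AE y in lborel. norm (indicat_real (ball (fst (z n)) (snd (z n))) y *\<^sub>R \<phi> y)
        \<le> B * indicat_real (cball 0 (R + R)) y" for n
    proof (rule AE_I2)
      fix y
      show "norm (indicat_real (ball (fst (z n)) (snd (z n))) y *\<^sub>R \<phi> y)
        \<le> B * indicat_real (cball 0 (R + R)) y"
        using B[of y] sub[of n] by (cases "y \<in> cball 0 (R + R)") (auto simp: indicator_def)
    qed
    show "AE y in lborel. (\<lambda>n. indicat_real (ball (fst (z n)) (snd (z n))) y *\<^sub>R \<phi> y)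
        \<longlonglongrightarrow> indicat_real (ball x r) y *\<^sub>R \<phi> y"
    proof (rule AE_I'[OF null], safe)
      fix y
      assume nc: "\<not> (\<lambda>n. indicat_real (ball (fst (z n)) (snd (z n))) y *\<^sub>R \<phi> y)
        \<longlonglongrightarrow> indicat_real (ball x r) y *\<^sub>R \<phi> y"
      show "y \<in> sphere x r"
      proof (rule ccontr)
        assume "y \<notin> sphere x r"
        then consider "dist x y - r < 0" | "dist x y - r > 0" by fastforce
        then have "\<forall>\<^sub>F n in sequentially.
            indicat_real (ball (fst (z n)) (snd (z n))) y = indicat_real (ball x r) y"
        proof cases
          case 1
          have "(\<lambda>n. dist (fst (z n)) y - snd (z n)) \<longlonglongrightarrow> dist x y - r"
            by (intro tendsto_intros limx limr)
          from order_tendstoD(2)[OF this 1] show ?thesis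
            by eventually_elim (use 1 in \<open>auto simp: indicator_def\<close>)
        next
          case 2
          have "(\<lambda>n. dist (fst (z n)) y - snd (z n)) \<longlonglongrightarrow> dist x y - r"
            by (intro tendsto_intros limx limr)
          from order_tendstoD(1)[OF this 2] show ?thesis
            by eventually_elim (use 2 in \<open>auto simp: indicator_def\<close>)
        qed
        then have "\<forall>\<^sub>F n in sequentially. indicat_real (ball (fst (z n)) (snd (z n))) y *\<^sub>R \<phi> y
            = indicat_real (ball x r) y *\<^sub>R \<phi> y"
          by eventually_elim simp
        from tendsto_eventually[OF this] nc show False by contradiction
      qed
    qed
  qed (auto intro!: borel_measurable_times borel_measurable_indicator assms(1))
  then show "(\<lambda>n. case z n of (x, r) \<Rightarrow> LINT y:ball x r|lborel. \<phi> y)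
      \<longlonglongrightarrow> (case w of (x, r) \<Rightarrow> LINT y:ball x r|lborel. \<phi> y)"
    by (simp add: w case_prod_beta)
qed

text \<open>For each rational \<open>q\<close> the set \<open>{\<phi> < q}\<close> has a countable dense subset. The union of these subsets is a
  countable set that meets every ball in points with values arbitrarily close to the infimum of \<open>\<phi>\<close>
  over that ball. The near-minimizer is the first suitable point in an enumeration of this set.\<close>

lemma borel_near_minimizer_ball:
  fixes \<phi> :: "'a::euclidean_space \<Rightarrow> real"
  assumes bdd: "bdd_below (range \<phi>)" and "0 < \<delta>"
  obtains s where "s \<in> borel_measurable borel"
    "\<And>x r. 0 < r \<Longrightarrow> s (x, r) \<in> ball x r"
    "\<And>x r. 0 < r \<Longrightarrow> \<phi> (s (x, r)) < (INF y\<in>ball x r. \<phi> y) + \<delta>"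
proof -
  have bdd': "bdd_below (\<phi> ` S)" for S
    using bdd by (rule bdd_below_mono) auto
  have "\<exists>T. countable T \<and> T \<subseteq> {y. \<phi> y < q} \<and> {y. \<phi> y < q} \<subseteq> closure T" for q
    using separable[of "{y. \<phi> y < q}"] by metis
  then obtain D where D: "\<And>q. countable (D q)" "\<And>q. D q \<subseteq> {y. \<phi> y < q}"
    "\<And>q. {y. \<phi> y < q} \<subseteq> closure (D q)" by metis
  define E where "E = (\<Union>q\<in>\<rat>. D q)"
  have cE: "countable E" unfolding E_def using D(1) by (intro countable_UN countable_rat)
  have near: "\<exists>y\<in>E. y \<in> ball x r \<and> \<phi> y < (INF y\<in>ball x r. \<phi> y) + \<delta>" if "0 < r" for x r
  proof -
    obtain q where q: "q \<in> \<rat>" "(INF y\<in>ball x r. \<phi> y) < q" "q < (INF y\<in>ball x r. \<phi> y) + \<delta>"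
      using Rats_dense_in_real[of "INF y\<in>ball x r. \<phi> y" "(INF y\<in>ball x r. \<phi> y) + \<delta>"] \<open>0 < \<delta>\<close> by auto
    then obtain y where y: "y \<in> ball x r" "\<phi> y < q"
      using \<open>0 < r\<close> by (auto simp: cINF_less_iff[OF _ bdd'])
    then have "y \<in> closure (D q)" using D(3) by auto
    then have "ball x r \<inter> D q \<noteq> {}"
      using y(1) open_Int_closure_eq_empty[of "ball x r" "D q"] by auto
    then obtain y' where "y' \<in> ball x r" "y' \<in> D q" by auto
    then show ?thesis using D(2) q by (force simp: E_def)
  qed
  from near[of 1] have E_ne: "E \<noteq> {}" by auto
  define e where "e = from_nat_into E"
  define v where "v z = (if 0 < snd z then (INF y\<in>ball (fst z) (snd z). \<phi> y) else 0)"
    for z :: "'a \<times> real"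
  have [measurable]: "v \<in> borel_measurable borel"
  proof -
    let ?X = "UNIV \<times> {0<..} :: ('a \<times> real) set"
    have oX: "open ?X" by (intro open_Times) auto
    have "{z. v z < a} \<in> sets borel" for a
    proof -
      have "{z. v z < a} = {z \<in> ?X. (INF y\<in>ball (fst z) (snd z). \<phi> y) < a}
          \<union> (if 0 < a then - ?X else {})"
        by (auto simp: v_def)
      moreover have "openin (top_of_set ?X) {z \<in> ?X. (INF y\<in>ball (fst z) (snd z). \<phi> y) < a}"
        by (rule openin_INF_ball_less) (auto intro!: continuous_intros bdd)
      then have "open {z \<in> ?X. (INF y\<in>ball (fst z) (snd z). \<phi> y) < a}"
        using oX openin_open_trans by blast
      ultimately show ?thesis
        using borel_comp[OF borel_open[OF oX]]
        by (simp only:) (rule sets.Un, auto simp del: Compl_Times_UNIV1)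
    qed
    then show ?thesis by (simp add: borel_measurable_iff_less)
  qed
  define N where "N z = (LEAST i. dist (fst z) (e i) < snd z \<and> \<phi> (e i) < v z + \<delta>)" for z
  have [measurable]: "(\<lambda>z. dist (fst z) y) \<in> borel_measurable (borel :: ('a \<times> real) measure)" for y
    by (intro borel_measurable_continuous_onI continuous_intros)
  have [measurable]: "snd \<in> borel_measurable (borel :: ('a \<times> real) measure)"
    by (intro borel_measurable_continuous_onI continuous_intros)
  have N[measurable]: "N \<in> measurable borel (count_space UNIV)"
    unfolding N_def by measurable
  have ex: "dist x (e (N (x, r))) < r \<and> \<phi> (e (N (x, r))) < v (x, r) + \<delta>" if r: "0 < r" for x r
  proof -
    from near[OF r] obtain y where y: "y \<in> E" "y \<in> ball x r"
      "\<phi> y < (INF y\<in>ball x r. \<phi> y) + \<delta>" by blast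
    then obtain i where "e i = y" unfolding e_def using from_nat_into_surj[OF cE] by blast
    then have "dist (fst (x, r)) (e i) < snd (x, r) \<and> \<phi> (e i) < v (x, r) + \<delta>"
      using y r by (auto simp: v_def)
    from LeastI[of "\<lambda>i. dist (fst (x, r)) (e i) < snd (x, r) \<and> \<phi> (e i) < v (x, r) + \<delta>", OF this]
    show ?thesis by (simp add: N_def)
  qed
  show thesis
  proof (rule that)
    show "(\<lambda>z. e (N z)) \<in> borel_measurable borel"
      by (rule measurable_compose[OF N]) simp
    show "e (N (x, r)) \<in> ball x r" if "0 < r" for x r using ex[OF that] by auto
    show "\<phi> (e (N (x, r))) < (INF y\<in>ball x r. \<phi> y) + \<delta>" if "0 < r" for x r
      using ex[OF that] that by (auto simp: v_def)
  qed
qed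

section \<open>The bracket of the dynamic programming principle\<close>

text \<open>The average over a ball as an expectation, which is the form in which it appears in the law of a
  turn of the game.\<close>

definition ball_mean :: "('a::euclidean_space \<Rightarrow> real) \<Rightarrow> 'a \<Rightarrow> real \<Rightarrow> real" where
  "ball_mean \<phi> x r = (LINT y|uniform_measure lborel (ball x r). \<phi> y)"

lemma prob_space_uniform_ball: "0 < r \<Longrightarrow> prob_space (uniform_measure lborel (ball (x::'a::euclidean_space) r))"
  using content_ball_gt_0_iff[of x r] emeasure_lborel_ball_finite[of x r]
  by (intro prob_space_uniform_measure) (auto simp: measure_def simp del: content_ball_gt_0_iff)

lemma ball_mean_eq:
  fixes \<phi> :: "'a::euclidean_space \<Rightarrow> real"
  assumes [measurable]: "\<phi> \<in> borel_measurable borel" and "0 < r"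
  shows "ball_mean \<phi> x r = 1 / measure lborel (ball x r) * (LINT y:ball x r|lborel. \<phi> y)"
proof -
  have pos: "0 < measure lborel (ball x r)" using \<open>0 < r\<close> by simp
  have fin: "emeasure lborel (ball x r) \<noteq> \<infinity>"
    using emeasure_lborel_ball_finite[of x r] by simp
  have eq: "uniform_measure lborel (ball x r) =
    density lborel (\<lambda>y. ennreal (indicator (ball x r) y / measure lborel (ball x r)))"
    unfolding uniform_measure_def using pos fin
    by (intro density_cong)
       (auto simp: emeasure_eq_ennreal_measure indicator_def divide_ennreal ennreal_1[symmetric]
         simp del: ennreal_1)
  have "ball_mean \<phi> x r =
      (LINT y|lborel. indicator (ball x r) y / measure lborel (ball x r) * \<phi> y)"
    unfolding ball_mean_def eq using pos
    by (subst integral_real_density)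
      (auto intro!: borel_measurable_divide borel_measurable_indicator assms(1))
  also have "\<dots> = 1 / measure lborel (ball x r) * (LINT y:ball x r|lborel. \<phi> y)"
    unfolding set_lebesgue_integral_def
    by (subst integral_mult_right_zero[symmetric]) (simp add: mult.commute)
  finally show ?thesis .
qed

lemma integrable_uniform_ball:
  fixes \<phi> :: "'a::euclidean_space \<Rightarrow> real"
  assumes "\<phi> \<in> borel_measurable borel" "bounded (range \<phi>)" "0 < r"
  shows "integrable (uniform_measure lborel (ball x r)) \<phi>"
proof -
  interpret prob_space "uniform_measure lborel (ball x r)"
    by (rule prob_space_uniform_ball) fact
  obtain B where "\<And>y. norm (\<phi> y) \<le> B" using assms(2) by (auto simp: bounded_iff)
  then show ?thesis using assms(1) by (intro integrable_const_bound[where B = B]) auto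
qed

lemma ball_mean_mono:
  fixes \<phi> :: "'a::euclidean_space \<Rightarrow> real"
  assumes "\<phi> \<in> borel_measurable borel" "bounded (range \<phi>)"
    and "\<eta> \<in> borel_measurable borel" "bounded (range \<eta>)"
    and "\<And>y. \<phi> y \<le> \<eta> y" "0 < r"
  shows "ball_mean \<phi> x r \<le> ball_mean \<eta> x r"
  unfolding ball_mean_def using assms by (intro integral_mono integrable_uniform_ball)

lemma ball_mean_uminus: "ball_mean (\<lambda>y. - \<phi> y) x r = - ball_mean \<phi> x r"
  by (simp add: ball_mean_def)

lemma bounded_range_add_real:
  fixes \<phi> \<eta> :: "'a \<Rightarrow> real"
  assumes "bounded (range \<phi>)" "bounded (range \<eta>)"
  shows "bounded (range (\<lambda>y. \<phi> y + \<eta> y))"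
  using bounded_plus_comp[of \<phi> UNIV \<eta>] assms by simp

lemma bounded_range_bdd:
  fixes \<phi> :: "'a \<Rightarrow> real"
  assumes "bounded (range \<phi>)"
  shows "bdd_above (\<phi> ` S)" "bdd_below (\<phi> ` S)"
proof -
  have "bounded (\<phi> ` S)" using assms by (rule bounded_subset) auto
  then show "bdd_above (\<phi> ` S)" "bdd_below (\<phi> ` S)"
    by (auto intro: bounded_imp_bdd_above bounded_imp_bdd_below)
qed

text \<open>The dimension is a parameter of its own, since the radii and weights below mention it without
  mentioning the type of points.\<close>

locale tug_game =
  fixes p \<epsilon> :: real and d :: nat and \<Omega> :: "'a::euclidean_space set" and f g :: "'a \<Rightarrow> real"
  assumes p: "p > 2" and d: "d = DIM('a)" and open_Omega: "open \<Omega>" and bounded_Omega: "bounded \<Omega>"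
    and cont_f: "continuous_on (closure \<Omega>) f"
    and cont_g: "continuous_on (- \<Omega>) g" and bounded_g: "bounded (g ` (- \<Omega>))"
    and eps: "0 < \<epsilon>" "\<epsilon> < 1"
begin

abbreviation \<alpha> :: real where "\<alpha> \<equiv> alpha p"
abbreviation \<beta> :: real where "\<beta> \<equiv> beta p d"
abbreviation choices :: "real set" where "choices \<equiv> {c_min p \<epsilon>..c_max p \<epsilon>}"

definition heads_radius :: "real \<Rightarrow> real" where
  "heads_radius c = \<epsilon>\<^sup>2 * c powr (1 - \<alpha>)"

definition tug_radius :: "real \<Rightarrow> real" where
  "tug_radius c = gamma p d * \<epsilon> * c powr (- (\<alpha> / 2))"

text \<open>The expected value of \<open>\<phi>\<close> after a turn with constant \<open>c\<close> in which the move after heads is made by the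
  maximizing player and each player moves optimally, one for large and one for small \<open>\<phi>\<close>. Its infimum over \<open>c\<close> is \<open>A_plus\<close>. The case of
  \<open>A_minus\<close> is its mirror image under \<open>\<phi> \<mapsto> - \<phi>\<close>.\<close>

definition bracket :: "('a \<Rightarrow> real) \<Rightarrow> 'a \<Rightarrow> real \<Rightarrow> real" where
  "bracket \<phi> x c =
    \<alpha> * (SUP y\<in>ball x (heads_radius c). \<phi> y)
    + (1 - \<alpha>) * (\<beta> * (1 / 2 * (SUP y\<in>ball x (tug_radius c). \<phi> y)
        + 1 / 2 * (INF y\<in>ball x (tug_radius c). \<phi> y))
      + (1 - \<beta>) * ball_mean \<phi> x (tug_radius c))"

lemma alpha_bounds: "0 < \<alpha>" "\<alpha> < 1"
  using p by (auto simp: alpha_def)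

lemma beta_bounds: "0 < \<beta>" "\<beta> < 1"
proof -
  show "0 < \<beta>" "\<beta> < 1" using p by (auto simp: beta_def)
qed

lemma gamma_pos: "0 < gamma p d"
  using p by (auto simp: gamma_def intro!: add_pos_nonneg)

lemma c_min_pos: "0 < c_min p \<epsilon>" and c_min_le_c_max: "c_min p \<epsilon> \<le> c_max p \<epsilon>"
proof -
  show "0 < c_min p \<epsilon>" using eps by (simp add: c_min_def)
  have "c_min p \<epsilon> \<le> 1"
    unfolding c_min_def using eps alpha_bounds by (intro powr_le1) auto
  also have "1 \<le> c_max p \<epsilon>"
  proof -
    have "\<epsilon> powr 0 \<le> \<epsilon> powr (- (2 / (2 - \<alpha>)))"
      using eps alpha_bounds by (intro powr_mono') auto
    then show ?thesis using eps by (simp add: c_max_def)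
  qed
  finally show "c_min p \<epsilon> \<le> c_max p \<epsilon>" .
qed

lemma choices_pos: "c \<in> choices \<Longrightarrow> 0 < c"
  using c_min_pos by auto

lemma heads_radius_pos: "c \<in> choices \<Longrightarrow> 0 < heads_radius c"
  using choices_pos[of c] eps by (simp add: heads_radius_def)

lemma tug_radius_pos: "c \<in> choices \<Longrightarrow> 0 < tug_radius c"
  using choices_pos[of c] eps gamma_pos by (simp add: tug_radius_def)

lemma tug_radius_bounds:
  assumes "c \<in> choices"
  shows "tug_radius (c_max p \<epsilon>) \<le> tug_radius c" "tug_radius c \<le> tug_radius (c_min p \<epsilon>)"
  unfolding tug_radius_def
  using assms choices_pos[OF assms] c_min_pos gamma_pos eps alpha_bounds
  by (auto intro!: mult_left_mono powr_mono2')

lemma A_plus_eq: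
  assumes "\<phi> \<in> borel_measurable borel"
  shows "A_plus p \<epsilon> \<phi> x = (INF c\<in>choices. bracket \<phi> x c)"
  unfolding A_plus_def
  by (intro INF_cong refl)
    (use assms tug_radius_pos in
      \<open>simp add: d[symmetric] bracket_def mean_op_def Let_def ball_mean_eq heads_radius_def tug_radius_def mult.assoc\<close>)

lemma bracket_uminus:
  "bracket (\<lambda>y. - \<phi> y) x c =
    - (\<alpha> * (INF y\<in>ball x (heads_radius c). \<phi> y)
    + (1 - \<alpha>) * (\<beta> * (1 / 2 * (SUP y\<in>ball x (tug_radius c). \<phi> y)
        + 1 / 2 * (INF y\<in>ball x (tug_radius c). \<phi> y))
      + (1 - \<beta>) * ball_mean \<phi> x (tug_radius c)))"
  by (simp add: bracket_def SUP_uminus_real INF_uminus_real ball_mean_uminus algebra_simps)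

lemma A_minus_eq:
  assumes "\<phi> \<in> borel_measurable borel"
  shows "A_minus p \<epsilon> \<phi> x = - (INF c\<in>choices. bracket (\<lambda>y. - \<phi> y) x c)"
  unfolding A_minus_def bracket_uminus INF_uminus_real minus_minus
  by (intro SUP_cong refl)
    (use assms tug_radius_pos in
      \<open>simp add: d[symmetric] mean_op_def Let_def ball_mean_eq heads_radius_def tug_radius_def mult.assoc\<close>)

text \<open>Nothing is known about the points that suprema and infima select, so there \<open>\<psi>\<close> is estimated by its
  upper bound \<open>L\<close>. Only the random move, of probability \<open>(1 - \<alpha>) (1 - \<beta>)\<close>, sees the average of \<open>\<psi>\<close>.\<close>

lemma bracket_mono_add:
  assumes u: "u \<in> borel_measurable borel" "bounded (range u)"
    and v: "v \<in> borel_measurable borel" "bounded (range v)"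
    and \<psi>: "\<psi> \<in> borel_measurable borel" "\<And>y. 0 \<le> \<psi> y" "\<And>y. \<psi> y \<le> L"
    and K: "0 \<le> K" and le: "\<And>y. u y \<le> v y + K * \<psi> y" and c: "c \<in> choices"
  shows "bracket u x c \<le> bracket v x c
    + K * ((1 - (1 - \<alpha>) * (1 - \<beta>)) * L + (1 - \<alpha>) * (1 - \<beta>) * ball_mean \<psi> x (tug_radius c))"
proof -
  note r = heads_radius_pos[OF c] tug_radius_pos[OF c]
  have \<psi>b: "bounded (range \<psi>)"
    unfolding bounded_iff using \<psi>(2,3) by (intro exI[of _ L]) auto
  have le': "u y \<le> v y + K * L" for y
    using le[of y] mult_left_mono[OF \<psi>(3)[of y] K] by simp
  have sup: "(SUP y\<in>ball x s. u y) \<le> (SUP y\<in>ball x s. v y) + K * L" if "0 < s" for s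
  proof (rule cSUP_least)
    show "ball x s \<noteq> {}" using that by simp
    fix y assume "y \<in> ball x s"
    then have "v y \<le> (SUP y\<in>ball x s. v y)"
      by (intro cSUP_upper bounded_range_bdd v)
    then show "u y \<le> (SUP y\<in>ball x s. v y) + K * L" using le'[of y] by simp
  qed
  have inf: "(INF y\<in>ball x s. u y) \<le> (INF y\<in>ball x s. v y) + K * L" if "0 < s" for s
  proof -
    have "(INF y\<in>ball x s. u y) - K * L \<le> (INF y\<in>ball x s. v y)"
    proof (rule cINF_greatest)
      show "ball x s \<noteq> {}" using that by simp
      fix y assume "y \<in> ball x s"
      then have "(INF y\<in>ball x s. u y) \<le> u y"
        by (intro cINF_lower bounded_range_bdd u)
      then show "(INF y\<in>ball x s. u y) - K * L \<le> v y" using le'[of y] by simp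
    qed
    then show ?thesis by simp
  qed
  have "ball_mean u x (tug_radius c) \<le> ball_mean (\<lambda>y. v y + K * \<psi> y) x (tug_radius c)"
    using u v \<psi>(1) \<psi>b r le
    by (intro ball_mean_mono bounded_range_add_real bounded_scaleR_comp[of \<psi> UNIV K, simplified]) auto
  also have "\<dots> = ball_mean v x (tug_radius c) + K * ball_mean \<psi> x (tug_radius c)"
    unfolding ball_mean_def using u v \<psi>(1) \<psi>b r by (simp add: integrable_uniform_ball)
  finally have mean: "ball_mean u x (tug_radius c)
    \<le> ball_mean v x (tug_radius c) + K * ball_mean \<psi> x (tug_radius c)" .
  have "bracket u x c \<le>
    \<alpha> * ((SUP y\<in>ball x (heads_radius c). v y) + K * L)
    + (1 - \<alpha>) * (\<beta> * (1 / 2 * ((SUP y\<in>ball x (tug_radius c). v y) + K * L)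
        + 1 / 2 * ((INF y\<in>ball x (tug_radius c). v y) + K * L))
      + (1 - \<beta>) * (ball_mean v x (tug_radius c) + K * ball_mean \<psi> x (tug_radius c)))"
    unfolding bracket_def
    using alpha_bounds beta_bounds
    by (intro add_mono mult_left_mono sup inf mean r) auto
  also have "\<dots> = bracket v x c
    + K * ((1 - (1 - \<alpha>) * (1 - \<beta>)) * L + (1 - \<alpha>) * (1 - \<beta>) * ball_mean \<psi> x (tug_radius c))"
    by (simp add: bracket_def field_simps)
  finally show ?thesis .
qed

lemma bracket_const:
  assumes "c \<in> choices" shows "bracket (\<lambda>_. k) x c = k"
proof -
  interpret prob_space "uniform_measure lborel (ball x (tug_radius c))"
    using tug_radius_pos[OF assms] by (rule prob_space_uniform_ball)
  have "ball_mean (\<lambda>_. k) x (tug_radius c) = k"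
    using prob_space unfolding ball_mean_def by simp
  then show ?thesis
    using heads_radius_pos[OF assms] tug_radius_pos[OF assms] by (simp add: bracket_def field_simps)
qed

lemma bracket_bound:
  assumes u: "u \<in> borel_measurable borel" and B: "\<And>y. \<bar>u y\<bar> \<le> B" and c: "c \<in> choices"
  shows "\<bar>bracket u x c\<bar> \<le> B"
proof -
  have b: "bounded (range u)" using B by (auto simp: bounded_iff)
  have B': "u y \<le> B" "- B \<le> u y" for y using B[of y] by auto
  \<comment> \<open>both comparisons use the correction term with weight 0\<close>
  have "bracket u x c \<le> bracket (\<lambda>_. B) x c"
    using bracket_mono_add[OF u b _ _ _ _ _ order_refl _ c, of "\<lambda>_. B" "\<lambda>_. 0" 0] B'
    by (simp add: image_constant_conv)
  moreover have "bracket (\<lambda>_. - B) x c \<le> bracket u x c"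
    using bracket_mono_add[OF _ _ u b _ _ _ order_refl _ c, of "\<lambda>_. - B" "\<lambda>_. 0" 0] B'
    by (simp add: image_constant_conv)
  ultimately show ?thesis using bracket_const[OF c] by auto
qed

lemma bracket_bdd_below:
  assumes "u \<in> borel_measurable borel" "bounded (range u)"
  shows "bdd_below ((\<lambda>c. bracket u x c) ` choices)"
proof -
  obtain B where "\<And>y. norm (u y) \<le> B" using assms(2) by (auto simp: bounded_iff)
  then have "\<bar>bracket u x c\<bar> \<le> B" if "c \<in> choices" for c
    using bracket_bound[OF assms(1) _ that] by simp
  then show ?thesis by (intro bdd_belowI2[of _ "- B"]) (auto simp: abs_le_iff minus_le_iff)
qed

lemma fsigma_sublevels_bracket:
  assumes u: "u \<in> borel_measurable borel" "bounded (range u)"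
  shows "fsigma_sublevels (UNIV \<times> choices) (\<lambda>z. bracket u (fst z) (snd z))"
proof -
  let ?X = "UNIV \<times> choices :: ('a \<times> real) set"
  have cl: "closed ?X" by (intro closed_Times) auto
  note bdd = bounded_range_bdd[OF u(2)]
  have h: "continuous_on ?X (\<lambda>z. heads_radius (snd z))"
    unfolding heads_radius_def using c_min_pos
    by (intro continuous_intros) auto
  have t: "continuous_on ?X (\<lambda>z. tug_radius (snd z))"
    unfolding tug_radius_def using c_min_pos
    by (intro continuous_intros) auto
  have sup: "fsigma_sublevels ?X (\<lambda>z. SUP y\<in>ball (fst z) (\<rho> z). u y)"
    if "continuous_on ?X \<rho>" "\<And>z. z \<in> ?X \<Longrightarrow> 0 < \<rho> z" for \<rho>
    by (intro fsigma_sublevels_lsc[OF cl] openin_SUP_ball_greater that bdd continuous_intros)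
  have inf: "fsigma_sublevels ?X (\<lambda>z. INF y\<in>ball (fst z) (\<rho> z). u y)"
    if "continuous_on ?X \<rho>" "\<And>z. z \<in> ?X \<Longrightarrow> 0 < \<rho> z" for \<rho>
    by (intro fsigma_sublevels_usc[OF cl] openin_INF_ball_less that bdd continuous_intros)
  have mean: "fsigma_sublevels ?X (\<lambda>z. ball_mean u (fst z) (tug_radius (snd z)))"
  proof (rule fsigma_sublevels_usc[OF cl])
    fix a
    obtain B where B: "\<And>y. \<bar>u y\<bar> \<le> B" using u(2) by (auto simp: bounded_iff)
    have "continuous_on ?X (\<lambda>z. case (fst z, tug_radius (snd z)) of (x, r) \<Rightarrow> LINT y:ball x r|lborel. u y)"
      by (rule continuous_on_compose2[OF continuous_on_ball_integral[OF u(1) B]])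
        (auto intro!: continuous_intros t)
    then have I: "continuous_on ?X (\<lambda>z. LINT y:ball (fst z) (tug_radius (snd z))|lborel. u y)"
      by simp
    have "continuous_on ?X (\<lambda>z. 1 / (unit_ball_vol DIM('a) * tug_radius (snd z) ^ DIM('a))
        * (LINT y:ball (fst z) (tug_radius (snd z))|lborel. u y))"
    proof (intro continuous_intros I t ballI)
      fix z assume "z \<in> ?X"
      then show "unit_ball_vol (real DIM('a)) * tug_radius (snd z) ^ DIM('a) \<noteq> 0"
        using tug_radius_pos[of "snd z"] unit_ball_vol_pos[of "real DIM('a)"]
        by (auto simp: less_imp_neq[symmetric])
    qed
    also have "?this \<longleftrightarrow> continuous_on ?X (\<lambda>z. ball_mean u (fst z) (tug_radius (snd z)))"
      using tug_radius_pos
      by (intro continuous_on_cong refl) (auto simp: ball_mean_eq[OF u(1)] content_ball less_imp_le)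
    finally have "openin (top_of_set ?X) (?X \<inter> (\<lambda>z. ball_mean u (fst z) (tug_radius (snd z))) -` {..<a})"
      by (intro continuous_openin_preimage_gen) auto
    also have "?X \<inter> (\<lambda>z. ball_mean u (fst z) (tug_radius (snd z))) -` {..<a}
      = {z \<in> ?X. ball_mean u (fst z) (tug_radius (snd z)) < a}" by auto
    finally show "openin (top_of_set ?X) {z \<in> ?X. ball_mean u (fst z) (tug_radius (snd z)) < a}" .
  qed
  show ?thesis
    unfolding bracket_def
    using alpha_bounds beta_bounds heads_radius_pos tug_radius_pos
    by (intro fsigma_sublevels_add fsigma_sublevels_scale[OF cl] sup inf mean h t) auto
qed

lemma borel_measurable_INF_bracket:
  assumes "u \<in> borel_measurable borel" "bounded (range u)"
  shows "(\<lambda>x. INF c\<in>choices. bracket u x c) \<in> borel_measurable borel"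
  using borel_measurable_section_INF[OF fsigma_sublevels_bracket[OF assms] c_min_le_c_max]
    bracket_bdd_below[OF assms] by simp

lemma borel_near_minimizer_bracket:
  assumes "u \<in> borel_measurable borel" "bounded (range u)" "0 < \<delta>"
  obtains s where "s \<in> borel_measurable borel" "\<And>x. s x \<in> choices"
    "\<And>x. bracket u x (s x) < (INF c\<in>choices. bracket u x c) + \<delta>"
  using borel_near_minimizer_section[OF fsigma_sublevels_bracket[OF assms(1,2)] c_min_le_c_max _ assms(3)]
    bracket_bdd_below[OF assms(1,2)] by auto

end

section \<open>A Lyapunov function and the solution of the dynamic programming principle\<close>

text \<open>The ball of radius \<open>r / 4\<close> about \<open>x + (3 / 4) r b\<close> is contained in \<open>ball x r\<close>, has \<open>(1 / 4) ^ DIM('a)\<close>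
  times its volume, and on it the coordinate in direction \<open>b\<close> exceeds that of \<open>x\<close> by at least \<open>r / 2\<close>.\<close>

lemma ball_mean_exp_lower_bound:
  fixes x b :: "'a::euclidean_space"
  assumes b: "norm b = 1" and "0 < r" "0 \<le> s" and h: "h \<in> borel_measurable borel" "bounded (range h)"
    and h0: "\<And>y. 0 \<le> h y" and hexp: "\<And>y. y \<in> ball x r \<Longrightarrow> exp (s * (y \<bullet> b)) \<le> h y"
  shows "(1 / 4) ^ DIM('a) * exp (s * r / 2) * exp (s * (x \<bullet> b)) \<le> ball_mean h x r"
proof -
  let ?U = "uniform_measure lborel (ball x r)"
  let ?S = "ball (x + (3 / 4 * r) *\<^sub>R b) (r / 4)"
  let ?k = "exp (s * r / 2) * exp (s * (x \<bullet> b))"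
  interpret prob_space ?U by (rule prob_space_uniform_ball) fact
  have S: "y \<in> ball x r" "x \<bullet> b + r / 2 \<le> y \<bullet> b" if "y \<in> ?S" for y
  proof -
    define v where "v = y - (x + (3 / 4 * r) *\<^sub>R b)"
    have v: "norm v < r / 4" using that by (simp add: v_def dist_norm norm_minus_commute)
    have y: "y - x = (3 / 4 * r) *\<^sub>R b + v" by (simp add: v_def)
    have "norm (y - x) \<le> 3 / 4 * r + norm v"
      unfolding y using \<open>0 < r\<close> b by (intro order_trans[OF norm_triangle_ineq]) simp
    then show "y \<in> ball x r" using v by (simp add: dist_norm norm_minus_commute)
    have "\<bar>v \<bullet> b\<bar> \<le> norm v" using Cauchy_Schwarz_ineq2[of v b] b by simp
    moreover have "(y - x) \<bullet> b = 3 / 4 * r + v \<bullet> b"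
      unfolding y using b by (simp add: inner_add_left dot_square_norm)
    ultimately show "x \<bullet> b + r / 2 \<le> y \<bullet> b"
      using v by (simp add: inner_diff_left)
  qed
  have "measure ?U ?S = measure lborel (ball x r \<inter> ?S) / measure lborel (ball x r)"
    using \<open>0 < r\<close> emeasure_lborel_ball_finite[of x r] content_ball_gt_0_iff[of x r]
    by (intro measure_uniform_measure) (auto simp: measure_def simp del: content_ball_gt_0_iff)
  also have "ball x r \<inter> ?S = ?S" using S(1) by blast
  also have "measure lborel ?S / measure lborel (ball x r) = (1 / 4) ^ DIM('a)"
    using \<open>0 < r\<close> unit_ball_vol_pos[of "real DIM('a)"]
    by (simp add: content_ball power_divide less_imp_neq[symmetric])
  finally have PS: "measure ?U ?S = (1 / 4) ^ DIM('a)" .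
  have "measure ?U ?S * ?k = (LINT y|?U. indicator ?S y * ?k)"
    by simp
  also have "\<dots> \<le> (LINT y|?U. h y)"
  proof (rule integral_mono)
    show "integrable ?U (\<lambda>y. indicat_real ?S y * ?k)"
      using emeasure_finite[of ?S]
      by (intro integrable_mult_left integrable_real_indicator)
        (auto simp: less_top[symmetric] simp del: emeasure_uniform_measure)
    show "integrable ?U h" using h \<open>0 < r\<close> by (rule integrable_uniform_ball)
    show "indicat_real ?S y * ?k \<le> h y" for y
    proof (cases "y \<in> ?S")
      case True
      have "?k = exp (s * (x \<bullet> b + r / 2))"
        by (simp add: exp_add[symmetric] algebra_simps)
      also have "\<dots> \<le> exp (s * (y \<bullet> b))"
        using S(2)[OF True] \<open>0 \<le> s\<close> by (simp add: mult_left_mono)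
      also have "\<dots> \<le> h y" using hexp S(1)[OF True] by simp
      finally show ?thesis using True by simp
    qed (simp add: h0)
  qed
  finally show ?thesis unfolding PS ball_mean_def by simp
qed

context tug_game
begin

text \<open>The left-hand side of the inequality is the largest possible expectation of \<open>\<psi>\<close> after a turn with
  constant \<open>c\<close>: the players are credited with the maximal value \<open>L\<close> whenever one of them moves. So \<open>\<psi>\<close>
  decreases by at least 1 per turn in expectation, regardless of the strategies.\<close>

definition lyapunov :: "('a \<Rightarrow> real) \<Rightarrow> real \<Rightarrow> bool" where
  "lyapunov \<psi> L \<longleftrightarrow> \<psi> \<in> borel_measurable borel \<and> 1 \<le> L \<and> (\<forall>y. 0 \<le> \<psi> y \<and> \<psi> y \<le> L) \<and>
    (\<forall>x\<in>\<Omega>. \<forall>c\<in>choices. (1 - (1 - \<alpha>) * (1 - \<beta>)) * L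
        + (1 - \<alpha>) * (1 - \<beta>) * ball_mean \<psi> x (tug_radius c) \<le> \<psi> x - 1)"

lemma noise_probability: "0 < (1 - \<alpha>) * (1 - \<beta>)" "(1 - \<alpha>) * (1 - \<beta>) \<le> 1"
  using alpha_bounds beta_bounds by (auto intro!: mult_le_one)

text \<open>Take \<open>\<psi> = L - E\<close> with \<open>E\<close> proportional to \<open>exp (s (y \<bullet> b))\<close>, truncated at \<open>L\<close>. The truncation has no
  effect at points that can be reached from the domain in one random move. The inequality reduces to
  \<open>E x + 1 \<le> \<kappa> E'\<close>, where \<open>E'\<close> is the average of \<open>E\<close> over the ball of the random move. For large \<open>s\<close>
  \<open>ball_mean_exp_lower_bound\<close> gives \<open>\<kappa> E' \<ge> 2 E x\<close>, and \<open>E\<close> is normalized to be at least 1 on the domain.\<close>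

lemma lyapunov_exists: "\<exists>\<psi> L. lyapunov \<psi> L"
proof -
  let ?\<kappa> = "(1 - \<alpha>) * (1 - \<beta>)"
  note \<kappa> = noise_probability
  obtain b :: 'a where "b \<in> Basis" using nonempty_Basis by blast
  then have b: "norm b = 1" by simp
  have le_norm: "\<bar>y \<bullet> b\<bar> \<le> norm y" for y using Cauchy_Schwarz_ineq2[of y b] b by simp
  obtain R where R: "0 < R" "\<And>x. x \<in> \<Omega> \<Longrightarrow> norm x \<le> R"
    using bounded_Omega unfolding bounded_pos by blast
  define r0 r1 where "r0 = tug_radius (c_max p \<epsilon>)" and "r1 = tug_radius (c_min p \<epsilon>)"
  have r0: "0 < r0" and r1: "0 < r1"
    using c_min_le_c_max by (auto simp: r0_def r1_def intro!: tug_radius_pos)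
  \<comment> \<open>only \<open>exp N \<ge> N\<close> is used: the exponential rate is chosen so that \<open>s r0 / 2 = N\<close>\<close>
  obtain N :: nat where N: "2 / (?\<kappa> * (1 / 4) ^ DIM('a)) < real N" using reals_Archimedean2 by blast
  define s where "s = real N * 2 / r0"
  have s: "0 \<le> s" using r0 by (simp add: s_def)
  have gain: "2 \<le> ?\<kappa> * ((1 / 4) ^ DIM('a) * exp (s * r / 2))" if "r0 \<le> r" for r
  proof -
    have pos: "0 < ?\<kappa> * (1 / 4) ^ DIM('a)" using \<kappa>(1) by (rule mult_pos_pos) simp
    have "real N \<le> exp (real N)" using exp_ge_add_one_self[of "real N"] by linarith
    also have "exp (real N) = exp (s * r0 / 2)" using r0 by (simp add: s_def)
    also have "exp (s * r0 / 2) \<le> exp (s * r / 2)" using that s by (simp add: mult_left_mono)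
    finally have "2 / (?\<kappa> * (1 / 4) ^ DIM('a)) \<le> exp (s * r / 2)" using N by linarith
    then have "2 \<le> exp (s * r / 2) * (?\<kappa> * (1 / 4) ^ DIM('a))"
      using pos by (simp only: pos_divide_le_eq)
    then show ?thesis by (simp only: mult_ac)
  qed
  define H where "H = exp (s * (R + r1))"
  define L where "L = H * exp (s * R)"
  define h where "h y = min (exp (s * (y \<bullet> b))) H" for y :: 'a
  have h_meas: "h \<in> borel_measurable borel" unfolding h_def by measurable
  have h_bounds: "0 \<le> h y" "h y \<le> H" for y by (auto simp: h_def H_def)
  have hb: "bounded (range h)" unfolding bounded_iff using h_bounds by (intro exI[of _ H]) auto
  have H1: "1 \<le> exp (s * R)" "1 \<le> H" using s R(1) r1 by (auto simp: H_def)
  \<comment> \<open>on the domain \<open>y \<bullet> b \<ge> - R\<close>, so the factor \<open>exp (s R)\<close> makes the subtracted term at least 1 there\<close>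
  define \<psi> where "\<psi> y = L - exp (s * R) * h y" for y
  have "lyapunov \<psi> L"
    unfolding lyapunov_def
  proof (intro conjI allI ballI)
    show "\<psi> \<in> borel_measurable borel" unfolding \<psi>_def using h_meas by measurable
    have "1 * 1 \<le> H * exp (s * R)" using H1 by (intro mult_mono) auto
    then show "1 \<le> L" by (simp add: L_def)
    show "0 \<le> \<psi> y" "\<psi> y \<le> L" for y
      using h_bounds[of y] H1 by (auto simp: \<psi>_def L_def mult.commute mult_right_mono)
    fix x c assume x: "x \<in> \<Omega>" and c: "c \<in> choices"
    define r where "r = tug_radius c"
    have r: "r0 \<le> r" "r \<le> r1" using tug_radius_bounds[OF c] by (auto simp: r_def r0_def r1_def)
    have hx: "h x = exp (s * (x \<bullet> b))"
      using le_norm[of x] R(2)[OF x] r1 s by (auto simp: h_def H_def min_def mult_left_mono)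
    have "- (s * R) \<le> s * (x \<bullet> b)"
      using mult_left_mono[of "- R" "x \<bullet> b" s] le_norm[of x] R(2)[OF x] s by auto
    then have "exp (- (s * R)) \<le> h x" unfolding hx by simp
    from mult_left_mono[OF this, of "exp (s * R)"] have Ex: "1 \<le> exp (s * R) * h x"
      by (simp add: exp_minus)
    have mean: "(1 / 4) ^ DIM('a) * exp (s * r / 2) * exp (s * (x \<bullet> b)) \<le> ball_mean h x r"
    proof (rule ball_mean_exp_lower_bound[OF b _ s h_meas hb h_bounds(1)])
      show "0 < r" using r r0 by simp
      fix y assume "y \<in> ball x r"
      then have "norm y \<le> norm x + r"
        using norm_triangle_ineq2[of y x] by (simp add: dist_norm norm_minus_commute)
      then have "y \<bullet> b \<le> R + r1" using le_norm[of y] R(2)[OF x] r by linarith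
      then show "exp (s * (y \<bullet> b)) \<le> h y" using s by (simp add: h_def H_def mult_left_mono)
    qed
    have "2 * h x \<le> ?\<kappa> * ((1 / 4) ^ DIM('a) * exp (s * r / 2)) * h x"
      using gain[OF r(1)] h_bounds(1) by (rule mult_right_mono)
    also have "\<dots> = ?\<kappa> * ((1 / 4) ^ DIM('a) * exp (s * r / 2) * exp (s * (x \<bullet> b)))"
      unfolding hx by (simp only: mult_ac)
    also have "\<dots> \<le> ?\<kappa> * ball_mean h x r" using mean \<kappa>(1) by (intro mult_left_mono) auto
    finally have m: "2 * h x \<le> ?\<kappa> * ball_mean h x r" .
    interpret prob_space "uniform_measure lborel (ball x r)"
      using r r0 by (intro prob_space_uniform_ball) simp
    have "integrable (uniform_measure lborel (ball x r)) h"
      using r r0 by (intro integrable_uniform_ball h_meas hb) simp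
    then have "ball_mean \<psi> x r = L - exp (s * R) * ball_mean h x r"
      unfolding ball_mean_def \<psi>_def using prob_space by simp
    moreover have "(1 - k) * L + k * (L - e * m) = L - e * (k * m)" for k e m :: real
      by (simp add: algebra_simps)
    ultimately have "(1 - ?\<kappa>) * L + ?\<kappa> * ball_mean \<psi> x r = L - exp (s * R) * (?\<kappa> * ball_mean h x r)"
      by (simp only:)
    also have "\<dots> \<le> L - exp (s * R) * (2 * h x)"
      using m by simp
    also have "\<dots> \<le> \<psi> x - 1" using Ex by (simp add: \<psi>_def mult.commute)
    finally show "(1 - ?\<kappa>) * L + ?\<kappa> * ball_mean \<psi> x (tug_radius c) \<le> \<psi> x - 1"
      by (simp add: r_def)
  qed
  then show ?thesis by blast
qed

text \<open>The extension by 0 is Borel on the whole space, whereas \<open>f\<close> is only known to be regular on the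
  closure of the domain.\<close>

definition run_cost :: "'a \<Rightarrow> real" where
  "run_cost x = (if x \<in> \<Omega> then \<epsilon>\<^sup>2 * J p (f x) else 0)"

lemma Omega_sets [measurable]: "\<Omega> \<in> sets borel"
  using open_Omega by simp

lemma borel_f_on_Omega [measurable]: "(\<lambda>x. if x \<in> \<Omega> then f x else 0) \<in> borel_measurable borel"
proof -
  have "f \<in> borel_measurable (restrict_space borel \<Omega>)"
    by (intro borel_measurable_continuous_on_restrict continuous_on_subset[OF cont_f closure_subset])
  then show ?thesis by (subst (asm) measurable_restrict_space_iff[where c = 0]) auto
qed

lemma nonneg_f_set [measurable]: "{x \<in> \<Omega>. 0 \<le> f x} \<in> sets borel"
proof -
  have "{x \<in> \<Omega>. 0 \<le> f x} = \<Omega> \<inter> {x. 0 \<le> (if x \<in> \<Omega> then f x else 0)}" by auto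
  also have "\<dots> \<in> sets borel" by measurable
  finally show ?thesis .
qed

lemma run_cost_measurable [measurable]: "run_cost \<in> borel_measurable borel"
proof -
  have "run_cost = (\<lambda>x. let y = (if x \<in> \<Omega> then f x else 0) in
    if x \<in> \<Omega> then \<epsilon>\<^sup>2 * (if y \<ge> 0 then y powr (1 / (p - 1)) else - ((- y) powr (1 / (p - 1)))) else 0)"
    by (auto simp: run_cost_def J_def)
  also have "\<dots> \<in> borel_measurable borel" unfolding Let_def by measurable
  finally show ?thesis .
qed

lemma run_cost_bounded: "\<exists>B\<ge>0. \<forall>x. \<bar>run_cost x\<bar> \<le> B"
proof -
  have "compact (f ` closure \<Omega>)"
    using cont_f bounded_Omega by (intro compact_continuous_image) (auto simp: compact_closure)
  then obtain F where F: "\<And>x. x \<in> closure \<Omega> \<Longrightarrow> \<bar>f x\<bar> \<le> F"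
    using compact_imp_bounded by (force simp: bounded_iff)
  have "\<bar>run_cost x\<bar> \<le> \<epsilon>\<^sup>2 * F powr (1 / (p - 1))" for x
  proof (cases "x \<in> \<Omega>")
    case True
    have "\<bar>J p (f x)\<bar> = \<bar>f x\<bar> powr (1 / (p - 1))" by (auto simp: J_def)
    also have "\<dots> \<le> F powr (1 / (p - 1))"
      using F[of x] True closure_subset p by (intro powr_mono2) auto
    finally show ?thesis using True by (simp add: run_cost_def abs_mult mult_left_mono)
  qed (simp add: run_cost_def)
  then show ?thesis by (intro exI[of _ "\<epsilon>\<^sup>2 * F powr (1 / (p - 1))"]) auto
qed

definition dpp :: "('a \<Rightarrow> real) \<Rightarrow> 'a \<Rightarrow> real" where
  "dpp u x = (if x \<in> \<Omega> then A_op p \<epsilon> f u x - run_cost x else g x)"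

definition bounded_borel :: "('a \<Rightarrow> real) \<Rightarrow> bool" where
  "bounded_borel u \<longleftrightarrow> u \<in> borel_measurable borel \<and> bounded (range u)"

lemma bounded_borel_uminus: "bounded_borel u \<Longrightarrow> bounded_borel (\<lambda>y. - u y)"
  by (auto simp: bounded_borel_def bounded_iff)

lemma solution_iff_fixed_point:
  "bounded_borel_dpp_solution p \<epsilon> \<Omega> f g u \<longleftrightarrow> bounded_borel u \<and> dpp u = u"
  by (auto simp: bounded_borel_dpp_solution_def bounded_borel_def dpp_def run_cost_def fun_eq_iff)

lemma borel_g_outside: "(\<lambda>x. if x \<in> \<Omega> then 0 else g x) \<in> borel_measurable borel"
proof -
  have "g \<in> borel_measurable (restrict_space borel (- \<Omega>))"
    by (intro borel_measurable_continuous_on_restrict cont_g)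
  then have "(\<lambda>x. if x \<in> - \<Omega> then g x else 0) \<in> borel_measurable borel"
    by (subst (asm) measurable_restrict_space_iff[where c = 0]) auto
  also have "(\<lambda>x. if x \<in> - \<Omega> then g x else 0) = (\<lambda>x. if x \<in> \<Omega> then 0 else g x)" by auto
  finally show ?thesis .
qed

lemma g_bound: "\<exists>B\<ge>0. \<forall>x. x \<notin> \<Omega> \<longrightarrow> \<bar>g x\<bar> \<le> B"
proof -
  obtain B where "0 < B" "\<forall>y\<in>g ` (- \<Omega>). norm y \<le> B"
    using bounded_g unfolding bounded_pos by blast
  then show ?thesis by (intro exI[of _ B]) auto
qed

lemma bounded_borel_dpp:
  assumes "bounded_borel u" shows "bounded_borel (dpp u)"
proof -
  have u: "u \<in> borel_measurable borel" "bounded (range u)" using assms by (auto simp: bounded_borel_def)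
  have u': "(\<lambda>y. - u y) \<in> borel_measurable borel" "bounded (range (\<lambda>y. - u y))"
    using bounded_borel_uminus[OF assms] by (auto simp: bounded_borel_def)
  note [measurable] = borel_measurable_INF_bracket[OF u] borel_measurable_INF_bracket[OF u'] borel_g_outside
  have eq: "dpp u = (\<lambda>x. if x \<in> \<Omega> then (if x \<in> {x \<in> \<Omega>. 0 \<le> f x} then (INF c\<in>choices. bracket u x c)
      else - (INF c\<in>choices. bracket (\<lambda>y. - u y) x c)) - run_cost x
      else (if x \<in> \<Omega> then 0 else g x))"
    by (auto simp: dpp_def A_op_def A_plus_eq[OF u(1)] A_minus_eq[OF u(1)])
  have "dpp u \<in> borel_measurable borel" unfolding eq by measurable
  moreover have "bounded (range (dpp u))"
  proof -
    obtain B where B: "\<And>y. \<bar>u y\<bar> \<le> B" using u(2) by (auto simp: bounded_iff)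
    obtain F where F: "\<And>x. \<bar>run_cost x\<bar> \<le> F" using run_cost_bounded by blast
    obtain G where G: "\<And>x. x \<notin> \<Omega> \<Longrightarrow> \<bar>g x\<bar> \<le> G" using g_bound by blast
    have INF: "\<bar>INF c\<in>choices. bracket v x c\<bar> \<le> B"
      if "v \<in> borel_measurable borel" "\<And>y. \<bar>v y\<bar> \<le> B" for v x
    proof -
      have b: "- B \<le> bracket v x c" "bracket v x c \<le> B" if "c \<in> choices" for c
        using bracket_bound[OF \<open>v \<in> borel_measurable borel\<close> \<open>\<And>y. \<bar>v y\<bar> \<le> B\<close> that, of x] by auto
      have "- B \<le> (INF c\<in>choices. bracket v x c)"
        using c_min_le_c_max by (intro cINF_greatest b) auto
      moreover have "(INF c\<in>choices. bracket v x c) \<le> B"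
        using c_min_le_c_max b(1)
        by (intro cINF_lower2[of _ _ "c_min p \<epsilon>"] b bdd_belowI2) auto
      ultimately show ?thesis by auto
    qed
    have "\<bar>dpp u x\<bar> \<le> B + F + \<bar>G\<bar>" for x
      using INF[OF u(1) B, of x] INF[OF u'(1), of x] F[of x] G[of x] B
      by (auto simp: eq)
    then show ?thesis by (auto simp: bounded_iff)
  qed
  ultimately show ?thesis by (simp add: bounded_borel_def)
qed

text \<open>An error of size \<open>K \<psi>\<close> becomes an error of size at most \<open>K (\<psi> x - 1)\<close> after one turn, and
  \<open>\<psi> - 1 \<le> (1 - 1 / L) \<psi>\<close> because \<open>\<psi> \<le> L\<close>.\<close>

lemma dpp_le:
  assumes \<psi>: "lyapunov \<psi> L" and u: "bounded_borel u" and v: "bounded_borel v"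
    and K: "0 \<le> K" and le: "\<And>y. \<bar>u y - v y\<bar> \<le> K * \<psi> y"
  shows "dpp u x \<le> dpp v x + K * (1 - 1 / L) * \<psi> x"
proof (cases "x \<in> \<Omega>")
  case False
  then show ?thesis using \<psi> K by (auto simp: dpp_def lyapunov_def intro!: mult_nonneg_nonneg)
next
  case True
  have \<psi>': "\<psi> \<in> borel_measurable borel" "\<And>y. 0 \<le> \<psi> y" "\<And>y. \<psi> y \<le> L" "1 \<le> L"
    using \<psi> by (auto simp: lyapunov_def)
  have step: "(INF c\<in>choices. bracket u x c) \<le> (INF c\<in>choices. bracket v x c) + K * (\<psi> x - 1)"
    if u: "bounded_borel u" and v: "bounded_borel v" and le: "\<And>y. u y \<le> v y + K * \<psi> y" for u v
  proof -
    have "(INF c\<in>choices. bracket u x c) - K * (\<psi> x - 1) \<le> (INF c\<in>choices. bracket v x c)"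
    proof (rule cINF_greatest)
      show "choices \<noteq> {}" using c_min_le_c_max by simp
      fix c assume c: "c \<in> choices"
      have "(INF c\<in>choices. bracket u x c) \<le> bracket u x c"
        using u c by (intro cINF_lower bracket_bdd_below) (auto simp: bounded_borel_def)
      also have "\<dots> \<le> bracket v x c
          + K * ((1 - (1 - \<alpha>) * (1 - \<beta>)) * L + (1 - \<alpha>) * (1 - \<beta>) * ball_mean \<psi> x (tug_radius c))"
        using u v by (intro bracket_mono_add[OF _ _ _ _ \<psi>'(1-3) K le c]) (auto simp: bounded_borel_def)
      also have "\<dots> \<le> bracket v x c + K * (\<psi> x - 1)"
        using \<psi> True c K by (intro add_left_mono mult_left_mono) (auto simp: lyapunov_def)
      finally show "(INF c\<in>choices. bracket u x c) - K * (\<psi> x - 1) \<le> bracket v x c" by simp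
    qed
    then show ?thesis by simp
  qed
  have le1: "u y \<le> v y + K * \<psi> y" and le2: "- v y \<le> - u y + K * \<psi> y" for y
    using le[of y] by auto
  have "A_op p \<epsilon> f u x \<le> A_op p \<epsilon> f v x + K * (\<psi> x - 1)"
    using step[OF u v le1] step[OF bounded_borel_uminus[OF v] bounded_borel_uminus[OF u] le2] u v
    by (auto simp: A_op_def bounded_borel_def A_plus_eq A_minus_eq)
  also have "K * (\<psi> x - 1) \<le> K * ((1 - 1 / L) * \<psi> x)"
    using K \<psi>'(3)[of x] \<psi>'(4) by (intro mult_left_mono) (auto simp: field_simps)
  finally show ?thesis using True by (simp add: dpp_def mult.assoc)
qed

lemma dpp_contraction:
  assumes "lyapunov \<psi> L" "bounded_borel u" "bounded_borel v" "0 \<le> K"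
    and le: "\<And>y. \<bar>u y - v y\<bar> \<le> K * \<psi> y"
  shows "\<bar>dpp u x - dpp v x\<bar> \<le> K * (1 - 1 / L) * \<psi> x"
  using dpp_le[OF assms, of x] dpp_le[OF assms(1,3,2,4), of x] le by (auto simp: abs_minus_commute)

lemma lyapunov_ge_1:
  assumes "lyapunov \<psi> L" "x \<in> \<Omega>" shows "1 \<le> \<psi> x"
proof -
  have c: "c_min p \<epsilon> \<in> choices" using c_min_le_c_max by simp
  have "0 \<le> ball_mean \<psi> x (tug_radius (c_min p \<epsilon>))"
    unfolding ball_mean_def using assms(1) by (intro Bochner_Integration.integral_nonneg) (auto simp: lyapunov_def)
  then have "0 \<le> (1 - (1 - \<alpha>) * (1 - \<beta>)) * L
        + (1 - \<alpha>) * (1 - \<beta>) * ball_mean \<psi> x (tug_radius (c_min p \<epsilon>))"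
    using noise_probability alpha_bounds beta_bounds assms(1)
    by (intro add_nonneg_nonneg mult_nonneg_nonneg[of "_ - _"] mult_nonneg_nonneg[of "_ * _"])
      (auto simp: lyapunov_def)
  also have "\<dots> \<le> \<psi> x - 1" using assms c unfolding lyapunov_def by blast
  finally show ?thesis by simp
qed

text \<open>Successive iterates differ by at most \<open>K \<theta>\<^sup>n \<psi>\<close> with \<open>\<theta> < 1\<close>, so they converge uniformly, and the
  contraction estimate also shows that the limit is a fixed point.\<close>

lemma solution_exists: "\<exists>u. bounded_borel_dpp_solution p \<epsilon> \<Omega> f g u"
proof -
  obtain \<psi> L where \<psi>: "lyapunov \<psi> L" using lyapunov_exists by blast
  have \<psi>': "0 \<le> \<psi> y" "\<psi> y \<le> L" "1 \<le> L" for y using \<psi> by (auto simp: lyapunov_def)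
  define \<theta> where "\<theta> = 1 - 1 / L"
  have \<theta>: "0 \<le> \<theta>" "\<theta> < 1" using \<psi>'(3) by (auto simp: \<theta>_def)
  define U where "U n = (dpp ^^ n) (\<lambda>x. if x \<in> \<Omega> then 0 else g x)" for n
  have U_Suc: "U (Suc n) = dpp (U n)" for n by (simp add: U_def)
  obtain G where G: "\<And>x. x \<notin> \<Omega> \<Longrightarrow> \<bar>g x\<bar> \<le> G" using g_bound by blast
  have "bounded_borel (U 0)"
    unfolding bounded_borel_def bounded_iff U_def using borel_g_outside G
    by (auto intro!: exI[of _ "\<bar>G\<bar>"] order_trans[OF G abs_ge_self])
  then have U: "bounded_borel (U n)" for n
    by (induction n) (auto simp: U_Suc bounded_borel_dpp)
  have "bounded_borel (U 1)" by (rule U)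
  then obtain K where K: "\<And>y. \<bar>U 1 y\<bar> \<le> K" by (auto simp: bounded_borel_def bounded_iff)
  have K0: "0 \<le> K" using K[of undefined] by simp
  have diff: "\<bar>U (Suc n) y - U n y\<bar> \<le> K * \<theta> ^ n * \<psi> y" for n y
  proof (induction n arbitrary: y)
    case 0
    show ?case
    proof (cases "y \<in> \<Omega>")
      case True
      then have "\<bar>U (Suc 0) y - U 0 y\<bar> \<le> K" using K[of y] by (simp add: U_def)
      also have "\<dots> \<le> K * \<psi> y" using lyapunov_ge_1[OF \<psi> True] K0 by (simp add: mult_le_cancel_left1)
      finally show ?thesis by simp
    next
      case False
      then show ?thesis using K0 \<psi>'(1) by (simp add: U_def dpp_def)
    qed
  next
    case (Suc n)
    have "\<bar>dpp (U (Suc n)) y - dpp (U n) y\<bar> \<le> K * \<theta> ^ n * (1 - 1 / L) * \<psi> y"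
      by (rule dpp_contraction[OF \<psi> U U _ Suc]) (use K0 \<theta> in auto)
    then show ?case by (simp add: U_Suc \<theta>_def mult_ac)
  qed
  have geo: "summable (\<lambda>k. K * \<theta> ^ k * \<psi> y)" for y
    using \<theta> by (intro summable_mult summable_mult2 summable_geometric) auto
  have summ: "summable (\<lambda>k. U (Suc k) y - U k y)" for y
    by (rule summable_comparison_test[OF _ geo]) (use diff in auto)
  define u where "u y = U 0 y + (\<Sum>k. U (Suc k) y - U k y)" for y
  have lim: "(\<lambda>n. U n y) \<longlonglongrightarrow> u y" for y
  proof -
    have "(\<lambda>n. U 0 y + (\<Sum>k<n. U (Suc k) y - U k y)) \<longlonglongrightarrow> u y"
      unfolding u_def by (intro tendsto_add tendsto_const summable_LIMSEQ summ)
    also have "(\<lambda>n. U 0 y + (\<Sum>k<n. U (Suc k) y - U k y)) = (\<lambda>n. U n y)"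
      using sum_lessThan_telescope[of "\<lambda>k. U k y"] by (simp add: fun_eq_iff)
    finally show ?thesis .
  qed
  \<comment> \<open>the factor \<open>L\<close> is the sum \<open>1 / (1 - \<theta>)\<close> of the geometric series\<close>
  have tail: "\<bar>u y - U n y\<bar> \<le> (K * L * \<theta> ^ n) * \<psi> y" for n y
  proof -
    have "\<bar>U m y - U n y\<bar> \<le> (K * L * \<theta> ^ n) * \<psi> y" if "n \<le> m" for m
    proof -
      have "\<bar>U m y - U n y\<bar> \<le> K * \<psi> y * L * (\<theta> ^ n - \<theta> ^ m)"
        using that
      proof (induction m rule: dec_induct)
        case (step m)
        have "\<bar>U (Suc m) y - U n y\<bar> \<le> K * \<psi> y * L * (\<theta> ^ n - \<theta> ^ m) + K * \<theta> ^ m * \<psi> y"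
          using step.IH diff[of m y] by linarith
        also have "\<dots> = K * \<psi> y * L * (\<theta> ^ n - \<theta> ^ m) + K * \<psi> y * L * (\<theta> ^ m * (1 - \<theta>))"
          using \<psi>'(3) by (simp add: \<theta>_def)
        also have "\<dots> = K * \<psi> y * L * (\<theta> ^ n - \<theta> ^ Suc m)" by (simp add: algebra_simps)
        finally show ?case .
      qed simp
      also have "\<dots> \<le> K * \<psi> y * L * \<theta> ^ n"
        using K0 \<psi>'(1)[of y] \<psi>'(3) \<theta> by (intro mult_left_mono) auto
      finally show ?thesis by (simp add: mult_ac)
    qed
    then have "\<forall>\<^sub>F m in sequentially. \<bar>U m y - U n y\<bar> \<le> (K * L * \<theta> ^ n) * \<psi> y"
      by (auto simp: eventually_sequentially)
    moreover have "(\<lambda>m. \<bar>U m y - U n y\<bar>) \<longlonglongrightarrow> \<bar>u y - U n y\<bar>" by (intro tendsto_intros lim)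
    ultimately show ?thesis by (intro tendsto_upperbound) auto
  qed
  have u: "bounded_borel u"
    unfolding bounded_borel_def
  proof
    show "u \<in> borel_measurable borel"
      by (rule borel_measurable_LIMSEQ_real[OF lim]) (use U in \<open>auto simp: bounded_borel_def\<close>)
    have "\<bar>u y\<bar> \<le> \<bar>G\<bar> + K * L * L" for y
    proof -
      have "\<bar>u y - U 0 y\<bar> \<le> K * L * L"
        using tail[of y 0] mult_left_mono[OF \<psi>'(2)[of y], of "K * L"] K0 \<psi>'(3) by simp
      moreover have "\<bar>U 0 y\<bar> \<le> \<bar>G\<bar>" using G[of y] by (auto simp: U_def)
      ultimately show ?thesis by linarith
    qed
    then show "bounded (range u)" by (auto simp: bounded_iff)
  qed
  have "dpp u x = u x" for x
  proof (rule LIMSEQ_unique)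
    have le: "norm (dpp (U n) x - dpp u x) \<le> (K * L * \<theta> * \<psi> x) * \<theta> ^ n" for n
    proof -
      have "\<bar>dpp u x - dpp (U n) x\<bar> \<le> K * L * \<theta> ^ n * (1 - 1 / L) * \<psi> x"
        by (rule dpp_contraction[OF \<psi> u U _ tail]) (use K0 \<psi>'(3) \<theta> in auto)
      then show ?thesis by (simp add: \<theta>_def mult_ac abs_minus_commute)
    qed
    have "(\<lambda>n. (K * L * \<theta> * \<psi> x) * \<theta> ^ n) \<longlonglongrightarrow> 0"
      using \<theta> by (intro tendsto_mult_right_zero LIMSEQ_power_zero) simp
    then have "(\<lambda>n. dpp (U n) x - dpp u x) \<longlonglongrightarrow> 0"
      by (rule Lim_null_comparison[OF always_eventually, rotated]) (use le in auto)
    then show "(\<lambda>n. U (Suc n) x) \<longlonglongrightarrow> dpp u x" by (simp add: U_Suc LIM_zero_iff)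
    show "(\<lambda>n. U (Suc n) x) \<longlonglongrightarrow> u x" using lim[of x] by (rule LIMSEQ_Suc)
  qed
  with u show ?thesis by (auto simp: solution_iff_fixed_point)
qed

end

section \<open>The law of the game\<close>

lemma (in Ionescu_Tulcea) C_eq_distr_lim:
  "C 0 n (\<lambda>_. undefined) = distr PF.lim (PiM {0..<n} M) (\<lambda>\<omega>. restrict \<omega> {0..<n})"
proof -
  have 0: "(\<lambda>_. undefined) \<in> space (PiM {0..<0} M)" by (simp add: space_PiM)
  have "up_to {0..<n} = n"
    unfolding up_to_def by (rule Least_equality) (auto simp: not_less_eq_eq intro: leI)
  then have "CI {0..<n} = distr (C 0 n (\<lambda>_. undefined)) (PiM {0..<n} M) (\<lambda>\<omega>. restrict \<omega> {0..<n})"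
    by (simp add: CI_def)
  also have "\<dots> = C 0 n (\<lambda>_. undefined)"
    using distr_C[OF order_refl 0, of n] by simp
  finally show ?thesis by (simp add: distr_lim)
qed

lemma (in Ionescu_Tulcea) prob_space_lim: "prob_space PF.lim"
proof -
  have "prob_space (distr PF.lim (PiM {0..<0} M) (\<lambda>\<omega>. restrict \<omega> {0..<0}))"
    unfolding C_eq_distr_lim[symmetric] by (rule prob_space_C) (simp add: space_PiM)
  then show ?thesis
    by (rule prob_space_distrD[rotated])
      (simp add: measurable_cong_sets[OF PF.sets_lim refl] measurable_restrict_subset)
qed

text \<open>The conditional law of coordinate \<open>n\<close> given the earlier ones is the kernel \<open>P n\<close>, stated for the
  expectation of a bounded function of the first \<open>n + 1\<close> coordinates under the infinite-dimensional law.\<close>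

lemma (in Ionescu_Tulcea) integral_lim_step:
  fixes F :: "_ \<Rightarrow> real"
  assumes F: "F \<in> borel_measurable (PiM {0..<Suc n} M)"
    and B: "\<And>\<omega>. \<omega> \<in> space (PiM {0..<Suc n} M) \<Longrightarrow> \<bar>F \<omega>\<bar> \<le> B"
  shows "(LINT \<omega>|PF.lim. F (restrict \<omega> {0..<Suc n})) =
    (LINT \<omega>|PF.lim. LINT t|P n (restrict \<omega> {0..<n}). F ((restrict \<omega> {0..<n})(n := t)))"
proof -
  let ?\<mu> = "\<lambda>n. C 0 n (\<lambda>_. undefined)"
  have 0: "(\<lambda>_. undefined) \<in> space (PiM {0..<0} M)" by (simp add: space_PiM)
  have restr: "(\<lambda>\<omega>. restrict \<omega> {0..<n}) \<in> measurable PF.lim (PiM {0..<n} M)" for n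
    by (simp add: measurable_cong_sets[OF PF.sets_lim refl] measurable_restrict_subset)
  interpret \<mu>: prob_space "?\<mu> n" by (rule prob_space_C[OF 0])
  have sets_\<mu>: "sets (?\<mu> n) = sets (PiM {0..<n} M)" using sets_C[OF 0, of n] by simp
  have space_\<mu>: "space (?\<mu> n) = space (PiM {0..<n} M)" using space_C[OF 0, of n] by simp
  have eP: "eP n \<in> measurable (?\<mu> n) (subprob_algebra (PiM {0..<Suc n} M))"
    using measurable_eP[of n] by (simp add: measurable_cong_sets[OF sets_\<mu> refl])
  have inner: "(LINT x|eP n \<omega>. F x) = (LINT t|P n \<omega>. F (fun_upd \<omega> n t))"
    if \<omega>: "\<omega> \<in> space (PiM {0..<n} M)" for \<omega>
    unfolding eP_def
  proof (rule integral_distr[OF _ F])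
    show "fun_upd \<omega> n \<in> measurable (P n \<omega>) (PiM {0..<Suc n} M)"
      using \<omega> by (intro measurable_fun_upd[where J = "{0..<n}"])
        (auto simp: measurable_cong_sets[OF sets_P[OF \<omega>] refl])
  qed
  have I: "(\<lambda>\<omega>. LINT x|eP n \<omega>. F x) \<in> borel_measurable (PiM {0..<n} M)"
    using integral_measurable_subprob_algebra[OF F] by (rule measurable_compose[OF measurable_eP])
  have "(LINT \<omega>|PF.lim. F (restrict \<omega> {0..<Suc n})) = (LINT \<omega>|?\<mu> (Suc n). F \<omega>)"
    unfolding C_eq_distr_lim by (rule integral_distr[OF restr F, symmetric])
  also have "\<dots> = (LINT \<omega>|?\<mu> n. LINT x|eP n \<omega>. F x)"
    using eP by (simp, intro integral_bind[OF F B, where B' = 1])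
      (auto simp: space_\<mu> prob_space_eP prob_space.emeasure_space_1 intro: \<mu>.finite_measure_axioms)
  also have "\<dots> = (LINT \<omega>|PF.lim. LINT x|eP n (restrict \<omega> {0..<n}). F x)"
    unfolding C_eq_distr_lim by (rule integral_distr[OF restr I])
  also have "\<dots> = (LINT \<omega>|PF.lim. LINT t|P n (restrict \<omega> {0..<n}). F ((restrict \<omega> {0..<n})(n := t)))"
    by (intro Bochner_Integration.integral_cong refl inner) (rule measurable_space[OF restr])
  finally show ?thesis .
qed

lemma measurable_position [measurable]:
  "position n \<in> measurable (history_space n) (borel :: 'a::euclidean_space measure)"
proof (cases n)
  case 0
  then show ?thesis
    by (simp add: position_def[abs_def] history_space_def cong: measurable_cong_sets)
next
  case (Suc k)
  have "(\<lambda>h. snd h k) \<in> measurable (history_space (Suc k)) (turn_space :: 'a turn measure)"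
    unfolding history_space_def
    by (rule measurable_compose[OF measurable_snd]) (rule measurable_component_singleton, simp)
  then have "(\<lambda>h. snd (snd (snd h k))) \<in> measurable (history_space (Suc k)) (borel :: 'a measure)"
    unfolding turn_space_def by measurable
  then show ?thesis by (simp add: Suc position_def[abs_def])
qed

lemma UNIV_toss: "(UNIV :: toss set) = {Heads, TugI, TugII, Noise}"
  using toss.exhaust by auto

lemma countable_toss: "countable (UNIV :: toss set)"
  unfolding UNIV_toss by simp

lemma subprob_space_uniform_ball:
  "subprob_space (uniform_measure lborel (ball (x::'a::euclidean_space) r))"
proof (cases "0 < r")
  case True
  then show ?thesis by (intro prob_space_imp_subprob_space prob_space_uniform_ball)
next
  case False
  then have e: "ball x r = {}" by simp
  show ?thesis unfolding uniform_measure_def e by (intro subprob_spaceI) (auto simp: emeasure_density)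
qed

text \<open>Balls of nonpositive radius are empty and give the zero measure, so the kernel is sub-Markovian for
  every radius function.\<close>

lemma measurable_uniform_ball:
  fixes X :: "'b \<Rightarrow> 'a::euclidean_space" and r :: "'b \<Rightarrow> real"
  assumes [measurable]: "X \<in> borel_measurable M" "r \<in> borel_measurable M"
  shows "(\<lambda>w. uniform_measure lborel (ball (X w) (r w))) \<in> measurable M (subprob_algebra borel)"
proof (rule measurable_subprob_algebra)
  fix A :: "'a set" assume [measurable]: "A \<in> sets borel"
  have meas: "(\<lambda>w. emeasure lborel (ball (X w) (r w) \<inter> A)) \<in> borel_measurable M"
    if [measurable]: "A \<in> sets borel" for A
  proof -
    let ?Q = "{z \<in> space (M \<Otimes>\<^sub>M lborel). dist (X (fst z)) (snd z) < r (fst z) \<and> snd z \<in> A}"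
    have "?Q \<in> sets (M \<Otimes>\<^sub>M lborel)" by measurable
    from lborel.measurable_emeasure_Pair[OF this]
    show ?thesis
    proof (rule measurable_cong[THEN iffD1, rotated])
      fix w assume "w \<in> space M"
      then have "Pair w -` ?Q = ball (X w) (r w) \<inter> A" by (auto simp: space_pair_measure)
      then show "emeasure lborel (Pair w -` ?Q) = emeasure lborel (ball (X w) (r w) \<inter> A)" by simp
    qed
  qed
  have "(\<lambda>w. emeasure lborel (ball (X w) (r w) \<inter> A) / emeasure lborel (ball (X w) (r w) \<inter> UNIV))
      \<in> borel_measurable M"
    by (intro borel_measurable_divide_ennreal meas) auto
  also have "(\<lambda>w. emeasure lborel (ball (X w) (r w) \<inter> A) / emeasure lborel (ball (X w) (r w) \<inter> UNIV))
      = (\<lambda>w. emeasure (uniform_measure lborel (ball (X w) (r w))) A)"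
    by (subst emeasure_uniform_measure) auto
  finally show "(\<lambda>w. emeasure (uniform_measure lborel (ball (X w) (r w))) A) \<in> borel_measurable M" .
qed (auto simp: subprob_space_uniform_ball)

lemma integral_toss_pmf:
  fixes F :: "toss \<Rightarrow> real"
  assumes "0 \<le> alpha p" "alpha p \<le> 1" "0 \<le> beta p d" "beta p d \<le> 1"
  shows "(LINT t|measure_pmf (toss_pmf p d). F t) = alpha p * F Heads
    + (1 - alpha p) * (beta p d * (1 / 2 * F TugI + 1 / 2 * F TugII) + (1 - beta p d) * F Noise)"
proof -
  have pmf: "pmf (toss_pmf p d) Heads = alpha p"
    "pmf (toss_pmf p d) TugI = (1 - alpha p) * (beta p d / 2)"
    "pmf (toss_pmf p d) TugII = (1 - alpha p) * (beta p d / 2)"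
    "pmf (toss_pmf p d) Noise = (1 - alpha p) * (1 - beta p d)"
    using assms by (simp_all add: toss_pmf_def pmf_bind map_pmf_def)
  have "(LINT t|measure_pmf (toss_pmf p d). F t) = (\<Sum>t\<in>UNIV. pmf (toss_pmf p d) t *\<^sub>R F t)"
    by (rule integral_measure_pmf) (simp add: UNIV_toss, rule UNIV_I)
  also have "\<dots> = alpha p * F Heads
    + (1 - alpha p) * (beta p d * (1 / 2 * F TugI + 1 / 2 * F TugII) + (1 - beta p d) * F Noise)"
    by (simp add: UNIV_toss pmf algebra_simps)
  finally show ?thesis .
qed

locale play = tug_game p \<epsilon> d \<Omega> f g
  for p \<epsilon> d and \<Omega> :: "'a::euclidean_space set" and f g +
  fixes S_I S_II :: "'a strategy"
  assumes S_I: "S_I \<in> strategies_I p \<epsilon> \<Omega> f" and S_II: "S_II \<in> strategies_II p \<epsilon> \<Omega> f"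
begin

definition chosen :: "nat \<Rightarrow> 'a history \<Rightarrow> real" where
  "chosen n h = (if f (position n h) \<ge> 0 then const S_II n h else const S_I n h)"

definition on_heads :: "nat \<Rightarrow> 'a history \<Rightarrow> 'a" where
  "on_heads n h = (if f (position n h) \<ge> 0 then heads_move S_I n h (chosen n h)
    else heads_move S_II n h (chosen n h))"

definition next_position :: "nat \<Rightarrow> 'a history \<Rightarrow> toss \<Rightarrow> 'a measure" where
  "next_position n h t = (case t of
      Heads \<Rightarrow> return borel (on_heads n h)
    | TugI \<Rightarrow> return borel (tug_move S_I n h (chosen n h))
    | TugII \<Rightarrow> return borel (tug_move S_II n h (chosen n h))
    | Noise \<Rightarrow> uniform_measure lborel (ball (position n h) (tug_radius (chosen n h))))"

abbreviation law :: "nat \<Rightarrow> 'a history \<Rightarrow> 'a turn measure" where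
  "law \<equiv> turn_law p \<epsilon> \<Omega> f S_I S_II"

lemma law_eq:
  "law n h = (if position n h \<in> \<Omega>
    then measure_pmf (toss_pmf p d) \<bind>
      (\<lambda>t. distr (next_position n h t) turn_space (\<lambda>y. (chosen n h, t, y)))
    else return turn_space (0, Noise, position n h))"
  by (simp add: turn_law_def Let_def next_position_def[abs_def] chosen_def on_heads_def tug_radius_def
      d[symmetric] cong: if_cong toss.case_cong)

lemma strategy_measurable:
  "const S_I n \<in> borel_measurable (history_space n)"
  "const S_II n \<in> borel_measurable (history_space n)"
  "case_prod (heads_move S_I n) \<in> borel_measurable (history_space n \<Otimes>\<^sub>M borel)"
  "case_prod (heads_move S_II n) \<in> borel_measurable (history_space n \<Otimes>\<^sub>M borel)"
  "case_prod (tug_move S_I n) \<in> borel_measurable (history_space n \<Otimes>\<^sub>M borel)"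
  "case_prod (tug_move S_II n) \<in> borel_measurable (history_space n \<Otimes>\<^sub>M borel)"
  using S_I S_II by (auto simp: strategies_I_def strategies_II_def admissible_def)

lemma chosen_in_choices:
  assumes "h \<in> space (history_space n)" "position n h \<in> \<Omega>"
  shows "chosen n h \<in> choices"
  using S_I S_II assms unfolding strategies_I_def strategies_II_def admissible_def chosen_def
  by (auto simp: not_le[symmetric] simp del: atLeastAtMost_iff)

lemma move_in_ball:
  assumes "h \<in> space (history_space n)" "position n h \<in> \<Omega>"
  shows "on_heads n h \<in> ball (position n h) (heads_radius (chosen n h))"
    and "tug_move S_I n h (chosen n h) \<in> ball (position n h) (tug_radius (chosen n h))"
    and "tug_move S_II n h (chosen n h) \<in> ball (position n h) (tug_radius (chosen n h))"
  using S_I S_II assms chosen_in_choices[OF assms]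
  unfolding strategies_I_def strategies_II_def admissible_def on_heads_def tug_radius_def heads_radius_def
    d[symmetric]
  by (auto simp: not_le[symmetric] simp del: atLeastAtMost_iff mem_ball)

text \<open>The functions \<open>chosen\<close> and \<open>on_heads\<close> branch on the sign of \<open>f\<close>, which may fail to be Borel off the
  closure of the domain. The following variants agree with them at positions in the domain and
  branch on a Borel set.\<close>

definition guarded_chosen :: "nat \<Rightarrow> 'a history \<Rightarrow> real" where
  "guarded_chosen n h = (if position n h \<in> {x \<in> \<Omega>. 0 \<le> f x} then const S_II n h else const S_I n h)"

definition guarded_on_heads :: "nat \<Rightarrow> 'a history \<Rightarrow> 'a" where
  "guarded_on_heads n h = (if position n h \<in> {x \<in> \<Omega>. 0 \<le> f x} then heads_move S_I n h (guarded_chosen n h)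
    else heads_move S_II n h (guarded_chosen n h))"

lemma measurable_guarded_chosen [measurable]: "guarded_chosen n \<in> borel_measurable (history_space n)"
  unfolding guarded_chosen_def[abs_def] using strategy_measurable(1,2)[of n] nonneg_f_set by measurable

lemma measurable_guarded_move:
  assumes "case_prod (m :: 'a history \<Rightarrow> real \<Rightarrow> 'a) \<in> borel_measurable (history_space n \<Otimes>\<^sub>M borel)"
  shows "(\<lambda>h. m h (guarded_chosen n h)) \<in> borel_measurable (history_space n)"
  using measurable_compose[OF measurable_Pair[OF measurable_ident measurable_guarded_chosen] assms]
  by simp

lemma measurable_guarded_on_heads [measurable]: "guarded_on_heads n \<in> borel_measurable (history_space n)"
  unfolding guarded_on_heads_def[abs_def]
  using measurable_guarded_move[OF strategy_measurable(3)] measurable_guarded_move[OF strategy_measurable(4)] nonneg_f_set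
  by measurable

lemma measurable_law: "law n \<in> measurable (history_space n) (subprob_algebra turn_space)"
proof -
  define nxt where "nxt h t = (case t of
      Heads \<Rightarrow> return borel (guarded_on_heads n h)
    | TugI \<Rightarrow> return borel (tug_move S_I n h (guarded_chosen n h))
    | TugII \<Rightarrow> return borel (tug_move S_II n h (guarded_chosen n h))
    | Noise \<Rightarrow> uniform_measure lborel (ball (position n h) (tug_radius (guarded_chosen n h))))" for h t
  have eq: "law n = (\<lambda>h. if position n h \<in> \<Omega>
    then measure_pmf (toss_pmf p d) \<bind> (\<lambda>t. distr (nxt h t) turn_space (\<lambda>y. (guarded_chosen n h, t, y)))
    else return turn_space (0, Noise, position n h))"
    by (auto simp: law_eq fun_eq_iff next_position_def nxt_def chosen_def guarded_chosen_def on_heads_def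
        guarded_on_heads_def split: toss.split intro!: arg_cong2[where f = bind])
  have tr: "(\<lambda>h. tug_radius (guarded_chosen n h)) \<in> borel_measurable (history_space n)"
    unfolding tug_radius_def by measurable
  have nxt: "(\<lambda>h. nxt h t) \<in> measurable (history_space n) (subprob_algebra borel)" for t
    unfolding nxt_def
    by (cases t) (auto intro!: measurable_compose[OF _ return_measurable] measurable_guarded_move
        strategy_measurable measurable_uniform_ball tr)
  have "(\<lambda>h. distr (nxt h t) turn_space (\<lambda>y. (guarded_chosen n h, t, y)))
      \<in> measurable (history_space n) (subprob_algebra turn_space)" for t
    unfolding turn_space_def by (rule measurable_distr2[OF _ nxt]) measurable
  then have branch: "(\<lambda>z. distr (nxt (fst z) (snd z)) turn_space (\<lambda>y. (guarded_chosen n (fst z), snd z, y)))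
      \<in> measurable (history_space n \<Otimes>\<^sub>M count_space UNIV) (subprob_algebra turn_space)"
    by (intro measurable_compose_countable'[where I = UNIV and g = snd
          and f = "\<lambda>t z. distr (nxt (fst z) t) turn_space (\<lambda>y. (guarded_chosen n (fst z), t, y))"]
        countable_toss) auto
  have "(\<lambda>h. measure_pmf (toss_pmf p d) \<bind> (\<lambda>t. distr (nxt h t) turn_space (\<lambda>y. (guarded_chosen n h, t, y))))
      \<in> measurable (history_space n) (subprob_algebra turn_space)"
    by (rule measurable_bind[OF _ branch]) (simp add: measure_pmf_in_subprob_algebra)
  moreover have "(\<lambda>h. return turn_space (0, Noise, position n h))
      \<in> measurable (history_space n) (subprob_algebra turn_space)"
    by (rule measurable_compose[OF _ return_measurable]) (unfold turn_space_def, measurable)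
  ultimately show ?thesis unfolding eq by measurable
qed

lemma next_position_props:
  assumes "h \<in> space (history_space n)" "position n h \<in> \<Omega>"
  shows "prob_space (next_position n h t)" "sets (next_position n h t) = sets borel"
  using tug_radius_pos[OF chosen_in_choices[OF assms]]
  by (auto simp: next_position_def prob_space_uniform_ball prob_space_return split: toss.split)

lemma turn_distr_props:
  assumes "h \<in> space (history_space n)" "position n h \<in> \<Omega>"
  shows "(\<lambda>y. (chosen n h, t, y)) \<in> measurable (next_position n h t) turn_space"
    and "prob_space (distr (next_position n h t) turn_space (\<lambda>y. (chosen n h, t, y)))"
proof -
  show m: "(\<lambda>y. (chosen n h, t, y)) \<in> measurable (next_position n h t) turn_space"
    unfolding turn_space_def measurable_cong_sets[OF next_position_props(2)[OF assms] refl] by measurable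
  show "prob_space (distr (next_position n h t) turn_space (\<lambda>y. (chosen n h, t, y)))"
    by (rule prob_space.prob_space_distr[OF next_position_props(1)[OF assms] m])
qed

lemma turn_kernel:
  assumes "h \<in> space (history_space n)" "position n h \<in> \<Omega>"
  shows "(\<lambda>t. distr (next_position n h t) turn_space (\<lambda>y. (chosen n h, t, y)))
    \<in> measurable (measure_pmf (toss_pmf p d)) (subprob_algebra turn_space)"
  using turn_distr_props(2)[OF assms]
  by (auto simp: space_subprob_algebra prob_space_imp_subprob_space)

lemma prob_space_law:
  assumes "h \<in> space (history_space n)"
  shows "prob_space (law n h)"
proof (cases "position n h \<in> \<Omega>")
  case True
  then show ?thesis
    unfolding law_eq using turn_distr_props(2)[OF assms True]
    by (auto intro!: measure_pmf.prob_space_bind[OF _ turn_kernel[OF assms True]])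
next
  case False
  then show ?thesis by (auto simp: law_eq turn_space_def space_pair_measure intro!: prob_space_return)
qed

lemma measurable_turn_position: "(\<lambda>t. snd (snd t)) \<in> measurable turn_space (borel :: 'a measure)"
  unfolding turn_space_def by measurable

lemma integral_law:
  assumes h: "h \<in> space (history_space n)" "position n h \<in> \<Omega>" and V: "bounded_borel V"
  shows "(LINT t|law n h. V (snd (snd t))) = \<alpha> * V (on_heads n h)
    + (1 - \<alpha>) * (\<beta> * (1 / 2 * V (tug_move S_I n h (chosen n h)) + 1 / 2 * V (tug_move S_II n h (chosen n h)))
      + (1 - \<beta>) * ball_mean V (position n h) (tug_radius (chosen n h)))"
proof -
  have Vm: "V \<in> borel_measurable borel" using V by (simp add: bounded_borel_def)
  obtain B where B: "\<And>y. \<bar>V y\<bar> \<le> B" using V by (auto simp: bounded_borel_def bounded_iff)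
  have V': "(\<lambda>t. V (snd (snd t))) \<in> borel_measurable turn_space"
    by (rule measurable_compose[OF measurable_turn_position Vm])
  have mass: "emeasure (distr (next_position n h t) turn_space (\<lambda>y. (chosen n h, t, y))) (space turn_space) = 1" for t
    using prob_space.emeasure_space_1[OF turn_distr_props(2)[OF h], of t] by simp
  have "(LINT t|law n h. V (snd (snd t))) = (LINT t|measure_pmf (toss_pmf p d).
      LINT z|distr (next_position n h t) turn_space (\<lambda>y. (chosen n h, t, y)). V (snd (snd z)))"
    using h unfolding law_eq
    by (simp, intro integral_bind[OF V' B turn_kernel[OF h], where B' = 1])
      (auto simp: mass measure_pmf.finite_measure_axioms)
  also have "\<dots> = (LINT t|measure_pmf (toss_pmf p d). LINT y|next_position n h t. V y)"
    by (subst integral_distr[OF turn_distr_props(1)[OF h] V']) simp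
  also have "\<dots> = \<alpha> * V (on_heads n h)
    + (1 - \<alpha>) * (\<beta> * (1 / 2 * V (tug_move S_I n h (chosen n h)) + 1 / 2 * V (tug_move S_II n h (chosen n h)))
      + (1 - \<beta>) * ball_mean V (position n h) (tug_radius (chosen n h)))"
    using alpha_bounds beta_bounds
    by (subst integral_toss_pmf) (auto simp: next_position_def integral_return Vm ball_mean_def)
  finally show ?thesis .
qed

end

section \<open>Supermartingales along the stopped game\<close>

definition alive :: "'a set \<Rightarrow> nat \<Rightarrow> 'a history \<Rightarrow> bool" where
  "alive \<Omega> n h \<longleftrightarrow> (\<forall>i\<le>n. position i h \<in> \<Omega>)"

text \<open>The increment of \<open>V\<close> along the game plus a running gain \<open>k\<close>, switched off after the exit. Stopping
  is thus built into the increments, and what happens to a path after the exit is irrelevant.\<close>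

definition drift ::
  "'a set \<Rightarrow> ('a \<Rightarrow> real) \<Rightarrow> ('a \<Rightarrow> real) \<Rightarrow> nat \<Rightarrow> 'a history \<Rightarrow> real" where
  "drift \<Omega> V k n h = of_bool (alive \<Omega> n h)
    * (V (position (Suc n) h) - V (position n h) + k (position n h))"

lemma not_alive_mono: "\<not> alive \<Omega> n h \<Longrightarrow> n \<le> i \<Longrightarrow> \<not> alive \<Omega> i h"
  unfolding alive_def by (meson order_trans)

lemma exit_time_props:
  assumes "\<not> alive \<Omega> n h"
  shows "position (exit_time \<Omega> h) h \<notin> \<Omega>" "exit_time \<Omega> h \<le> n"
proof -
  obtain i where i: "i \<le> n" "position i h \<notin> \<Omega>" using assms by (auto simp: alive_def)
  show "position (exit_time \<Omega> h) h \<notin> \<Omega>"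
    unfolding exit_time_def using i(2) by (rule LeastI)
  have "exit_time \<Omega> h \<le> i" unfolding exit_time_def using i(2) by (rule Least_le)
  with i(1) show "exit_time \<Omega> h \<le> n" by simp
qed

lemma before_exit_time: "i < exit_time \<Omega> h \<Longrightarrow> position i h \<in> \<Omega>"
  unfolding exit_time_def using not_less_Least by blast

lemma exit_time_eqI:
  assumes "alive \<Omega> n h" "\<not> alive \<Omega> (Suc n) h"
  shows "exit_time \<Omega> h = Suc n"
proof -
  have "\<not> exit_time \<Omega> h \<le> n"
    using assms(1) exit_time_props(1)[OF assms(2)] by (auto simp: alive_def)
  then show ?thesis using exit_time_props(2)[OF assms(2)] by simp
qed

text \<open>The drift vanishes after the exit, so the sum telescopes up to the stopped time \<open>\<sigma>\<close>, the minimum of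
  \<open>n\<close> and the exit time.\<close>

lemma sum_drift:
  defines "\<sigma> \<equiv> \<lambda>\<Omega> n h. if alive \<Omega> n h then n else exit_time \<Omega> h"
  shows "(\<Sum>i<n. drift \<Omega> V k i h) =
    V (position (\<sigma> \<Omega> n h) h) - V (position 0 h) + (\<Sum>i<\<sigma> \<Omega> n h. k (position i h))"
proof (induction n)
  case 0
  have "\<sigma> \<Omega> 0 h = 0" using exit_time_props(2)[of \<Omega> 0 h] by (auto simp: \<sigma>_def)
  then show ?case by simp
next
  case (Suc n)
  show ?case
  proof (cases "alive \<Omega> n h")
    case True
    then have "\<sigma> \<Omega> n h = n" "\<sigma> \<Omega> (Suc n) h = Suc n"
      using exit_time_eqI[OF True] by (auto simp: \<sigma>_def)
    then show ?thesis using Suc True by (simp add: drift_def)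
  next
    case False
    then have "\<not> alive \<Omega> (Suc n) h" by (rule not_alive_mono) simp
    then have "\<sigma> \<Omega> (Suc n) h = \<sigma> \<Omega> n h" using False by (simp add: \<sigma>_def)
    then show ?thesis using Suc False by (simp add: drift_def)
  qed
qed

lemma position_restrict: "i \<le> m \<Longrightarrow> position i (x, restrict \<omega> {0..<m}) = position i (x, \<omega>)"
  by (auto simp: position_def split: nat.split)

lemma position_fun_upd: "i \<le> n \<Longrightarrow> position i (x, (\<omega>)(n := t)) = position i (x, \<omega>)"
  by (auto simp: position_def split: nat.split)

lemma position_Suc_fun_upd: "position (Suc n) (x, (\<omega>)(n := t)) = snd (snd t)"
  by (simp add: position_def)

lemma drift_restrict: "drift \<Omega> V k n (x, restrict \<omega> {0..<Suc n}) = drift \<Omega> V k n (x, \<omega>)"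
  unfolding drift_def alive_def
  by (simp only: position_restrict[of "Suc n" "Suc n"] position_restrict[of n "Suc n"] order_refl le_SucI)
    (auto simp: position_restrict simp del: atLeastLessThanSuc intro!: arg_cong2[where f = "(*)"])

context play
begin

abbreviation game :: "'a \<Rightarrow> (nat \<Rightarrow> 'a turn) measure" where
  "game \<equiv> game_measure p \<epsilon> \<Omega> f S_I S_II"

lemma pair_history_space:
  "\<omega> \<in> space (PiM {0..<n} (\<lambda>_. turn_space)) \<Longrightarrow> (x0, \<omega>) \<in> space (history_space n)"
  by (simp add: history_space_def space_pair_measure)

lemma Ionescu_Tulcea_law: "Ionescu_Tulcea (\<lambda>n \<omega>. law n (x0, \<omega>)) (\<lambda>_. turn_space)"
proof (rule Ionescu_Tulcea.intro)
  show "(\<lambda>\<omega>. law n (x0, \<omega>)) \<in> measurable (PiM {0..<n} (\<lambda>_. turn_space)) (subprob_algebra turn_space)" for n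
    by (rule measurable_compose[OF _ measurable_law]) (simp add: history_space_def)
  fix n and \<omega> :: "nat \<Rightarrow> 'a turn" assume "\<omega> \<in> space (PiM {0..<n} (\<lambda>_. turn_space))"
  then show "prob_space (law n (x0, \<omega>))" by (intro prob_space_law pair_history_space)
qed

lemma prob_space_game: "prob_space (game x0)"
  unfolding game_measure_def by (rule Ionescu_Tulcea.prob_space_lim[OF Ionescu_Tulcea_law])

lemma sets_game: "sets (game x0) = sets (PiM UNIV (\<lambda>_. turn_space))"
proof -
  interpret Ionescu_Tulcea "\<lambda>n \<omega>. law n (x0, \<omega>)" "\<lambda>_. turn_space" by (rule Ionescu_Tulcea_law)
  show ?thesis unfolding game_measure_def by (rule PF.sets_lim)
qed

lemma measurable_position_path:
  assumes "{0..<n} \<subseteq> I"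
  shows "(\<lambda>\<omega>. position n (x0, \<omega>)) \<in> measurable (PiM I (\<lambda>_. turn_space)) (borel :: 'a measure)"
proof (cases n)
  case 0
  then show ?thesis by (simp add: position_def)
next
  case (Suc k)
  then have "(\<lambda>\<omega>. \<omega> k) \<in> measurable (PiM I (\<lambda>_. turn_space)) (turn_space :: 'a turn measure)"
    using assms by (intro measurable_component_singleton) auto
  from measurable_compose[OF this measurable_turn_position]
  show ?thesis by (simp add: Suc position_def)
qed

lemma measurable_drift_path:
  assumes "bounded_borel V" "bounded_borel k" "{0..<Suc n} \<subseteq> I"
  shows "(\<lambda>\<omega>. drift \<Omega> V k n (x0, \<omega>)) \<in> borel_measurable (PiM I (\<lambda>_. turn_space))"
proof -
  have [measurable]: "V \<in> borel_measurable borel" "k \<in> borel_measurable borel"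
    using assms by (auto simp: bounded_borel_def)
  have [measurable]: "(\<lambda>\<omega>. position i (x0, \<omega>)) \<in> measurable (PiM I (\<lambda>_. turn_space)) (borel :: 'a measure)"
    if "i \<le> Suc n" for i
    using that assms(3) by (intro measurable_position_path) auto
  have [measurable]: "Measurable.pred (PiM I (\<lambda>_. turn_space)) (\<lambda>\<omega>. alive \<Omega> n (x0, \<omega>))"
  proof -
    have "Measurable.pred (PiM I (\<lambda>_. turn_space)) (\<lambda>\<omega>. \<forall>i\<in>{..n}. position i (x0, \<omega>) \<in> \<Omega>)"
      by (rule pred_intros_finite) (auto intro!: pred_sets2[OF Omega_sets])
    then show ?thesis by (simp add: alive_def Ball_def atMost_iff)
  qed
  show ?thesis unfolding drift_def by measurable
qed

lemma drift_bounded: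
  assumes "bounded_borel V" "bounded_borel k"
  shows "\<exists>B\<ge>0. \<forall>n h. \<bar>drift \<Omega> V k n h\<bar> \<le> B * of_bool (alive \<Omega> n h)"
proof -
  obtain A where A: "\<And>y. \<bar>V y\<bar> \<le> A" using assms by (auto simp: bounded_borel_def bounded_iff)
  obtain C where C: "\<And>y. \<bar>k y\<bar> \<le> C" using assms by (auto simp: bounded_borel_def bounded_iff)
  have "\<bar>V x - V y + k y\<bar> \<le> 2 * A + C" for x y
    using A[of x] A[of y] C[of y] by linarith
  moreover have "0 \<le> 2 * A + C" using A[of undefined] C[of undefined] by linarith
  ultimately show ?thesis by (intro exI[of _ "2 * A + C"]) (auto simp: drift_def)
qed

lemma integrable_drift:
  assumes "bounded_borel V" "bounded_borel k"
  shows "integrable (game x0) (\<lambda>\<omega>. drift \<Omega> V k n (x0, \<omega>))"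
proof -
  interpret prob_space "game x0" by (rule prob_space_game)
  obtain B where B: "0 \<le> B" "\<And>n h. \<bar>drift \<Omega> V k n h\<bar> \<le> B * of_bool (alive \<Omega> n h)"
    using drift_bounded[OF assms] by blast
  have "\<bar>drift \<Omega> V k n h\<bar> \<le> B" for n h
    using B(2)[of n h] B(1) by (cases "alive \<Omega> n h") auto
  then show ?thesis
    using measurable_drift_path[OF assms, of n UNIV]
    by (intro integrable_const_bound[where B = B]) (auto simp: measurable_cong_sets[OF sets_game refl])
qed

text \<open>A pointwise bound for the conditional expectation of one step makes the stopped process a
  supermartingale; it is stated for its increments.\<close>

lemma integral_drift_nonpos:
  assumes V: "bounded_borel V" and k: "bounded_borel k"
    and step: "\<And>h. h \<in> space (history_space n) \<Longrightarrow> position n h \<in> \<Omega> \<Longrightarrow>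
      (LINT t|law n h. V (snd (snd t))) + k (position n h) \<le> V (position n h)"
  shows "(LINT \<omega>|game x0. drift \<Omega> V k n (x0, \<omega>)) \<le> 0"
proof -
  interpret IT: Ionescu_Tulcea "\<lambda>n \<omega>. law n (x0, \<omega>)" "\<lambda>_. turn_space" by (rule Ionescu_Tulcea_law)
  have game: "game x0 = IT.PF.lim" by (simp add: game_measure_def)
  obtain B where B: "0 \<le> B" "\<And>n h. \<bar>drift \<Omega> V k n h\<bar> \<le> B * of_bool (alive \<Omega> n h)"
    using drift_bounded[OF V k] by blast
  have B': "\<bar>drift \<Omega> V k n h\<bar> \<le> B" for n h
    using B(2)[of n h] B(1) by (cases "alive \<Omega> n h") auto
  let ?r = "\<lambda>\<omega>. restrict \<omega> {0..<n}"
  have "(LINT \<omega>|game x0. drift \<Omega> V k n (x0, \<omega>))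
    = (LINT \<omega>|game x0. drift \<Omega> V k n (x0, restrict \<omega> {0..<Suc n}))"
    by (simp only: drift_restrict)
  also have "\<dots> = (LINT \<omega>|game x0. LINT t|law n (x0, ?r \<omega>). drift \<Omega> V k n (x0, (?r \<omega>)(n := t)))"
    unfolding game
    by (rule IT.integral_lim_step[OF measurable_drift_path[OF V k] B']) simp
  also have "\<dots> = - (LINT \<omega>|game x0. - (LINT t|law n (x0, ?r \<omega>). drift \<Omega> V k n (x0, (?r \<omega>)(n := t))))"
    by simp
  also have "\<dots> \<le> 0"
    unfolding neg_le_0_iff_le
  proof (rule Bochner_Integration.integral_nonneg)
    fix \<omega> assume "\<omega> \<in> space (game x0)"
    define w where "w = ?r \<omega>"
    have "w \<in> space (PiM {0..<n} (\<lambda>_. turn_space))"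
      by (auto simp: w_def space_PiM turn_space_def space_pair_measure)
    then have h: "(x0, w) \<in> space (history_space n)" by (rule pair_history_space)
    let ?h = "(x0, w)"
    interpret law: prob_space "law n ?h" using h by (rule prob_space_law)
    have sets_law: "sets (law n ?h) = sets turn_space"
      using sets_kernel[OF measurable_law h] .
    obtain A where A: "\<And>y. \<bar>V y\<bar> \<le> A" using V by (auto simp: bounded_borel_def bounded_iff)
    have "integrable (law n ?h) (\<lambda>t. V (snd (snd t)))"
    proof (rule law.integrable_const_bound[where B = A])
      show "(\<lambda>t. V (snd (snd t))) \<in> borel_measurable (law n ?h)"
        using measurable_compose[OF measurable_turn_position, of V] V
        by (simp add: measurable_cong_sets[OF sets_law refl] bounded_borel_def)
    qed (use A in auto)
    moreover have "alive \<Omega> n (x0, (w)(n := t)) = alive \<Omega> n ?h" for t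
      by (auto simp: alive_def position_fun_upd)
    ultimately have "(LINT t|law n ?h. drift \<Omega> V k n (x0, (w)(n := t))) =
      of_bool (alive \<Omega> n ?h) * ((LINT t|law n ?h. V (snd (snd t))) - V (position n ?h) + k (position n ?h))"
      by (simp add: drift_def position_fun_upd position_Suc_fun_upd law.prob_space)
    also have "\<dots> \<le> 0"
      using step[OF h] by (auto simp: alive_def)
    finally show "0 \<le> - (LINT t|law n (x0, ?r \<omega>). drift \<Omega> V k n (x0, (?r \<omega>)(n := t)))"
      unfolding w_def by simp
  qed
  finally show ?thesis .
qed

lemma bounded_borel_const: "bounded_borel (\<lambda>_. c)"
  by (auto simp: bounded_borel_def bounded_iff)

lemma drift_0_1: "drift \<Omega> (\<lambda>_. 0) (\<lambda>_. 1) n h = of_bool (alive \<Omega> n h)"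
  by (simp add: drift_def)

text \<open>The drift of \<open>\<psi>\<close> with gain 1 has nonpositive expectation, and the total gain until time \<open>n\<close> is the
  number of turns played. Since \<open>0 \<le> \<psi> \<le> L\<close>, this number has expectation at most \<open>L\<close>.\<close>

lemma expected_duration:
  assumes \<psi>: "lyapunov \<psi> L"
  shows "(\<Sum>i<n. LINT \<omega>|game x0. of_bool (alive \<Omega> i (x0, \<omega>))) \<le> L"
proof -
  interpret prob_space "game x0" by (rule prob_space_game)
  have \<psi>': "0 \<le> \<psi> y" "\<psi> y \<le> L" for y using \<psi> by (auto simp: lyapunov_def)
  have \<psi>b: "bounded_borel \<psi>"
    using \<psi> \<psi>' by (auto simp: bounded_borel_def lyapunov_def bounded_iff intro!: exI[of _ L])
  have step: "(LINT t|law n h. \<psi> (snd (snd t))) + 1 \<le> \<psi> (position n h)"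
    if h: "h \<in> space (history_space n)" "position n h \<in> \<Omega>" for n h
  proof -
    let ?m = "ball_mean \<psi> (position n h) (tug_radius (chosen n h))"
    have "(LINT t|law n h. \<psi> (snd (snd t)))
      \<le> \<alpha> * L + (1 - \<alpha>) * (\<beta> * (1 / 2 * L + 1 / 2 * L) + (1 - \<beta>) * ?m)"
      unfolding integral_law[OF h \<psi>b] using alpha_bounds beta_bounds \<psi>'
      by (intro add_mono mult_left_mono) auto
    also have "\<dots> = (1 - (1 - \<alpha>) * (1 - \<beta>)) * L + (1 - \<alpha>) * (1 - \<beta>) * ?m"
      by (simp add: algebra_simps)
    also have "\<dots> \<le> \<psi> (position n h) - 1"
      using \<psi> chosen_in_choices[OF h] h(2) unfolding lyapunov_def by blast
    finally show ?thesis by simp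
  qed
  have "(\<Sum>i<n. LINT \<omega>|game x0. of_bool (alive \<Omega> i (x0, \<omega>)))
    = (LINT \<omega>|game x0. (\<Sum>i<n. drift \<Omega> (\<lambda>_. 0) (\<lambda>_. 1) i (x0, \<omega>)))"
    by (subst Bochner_Integration.integral_sum)
      (auto simp: drift_0_1[symmetric] intro!: integrable_drift bounded_borel_const)
  also have "\<dots> \<le> (LINT \<omega>|game x0. (\<Sum>i<n. drift \<Omega> \<psi> (\<lambda>_. 1) i (x0, \<omega>)) + L)"
  proof (intro integral_mono Bochner_Integration.integrable_add Bochner_Integration.integrable_sum
      integrable_drift \<psi>b bounded_borel_const integrable_const)
    fix \<omega>
    let ?s = "if alive \<Omega> n (x0, \<omega>) then n else exit_time \<Omega> (x0, \<omega>)"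
    show "(\<Sum>i<n. drift \<Omega> (\<lambda>_. 0) (\<lambda>_. 1) i (x0, \<omega>)) \<le> (\<Sum>i<n. drift \<Omega> \<psi> (\<lambda>_. 1) i (x0, \<omega>)) + L"
      unfolding sum_drift
      using \<psi>'(1)[of "position ?s (x0, \<omega>)"] \<psi>'(2)[of "position 0 (x0, \<omega>)"] by linarith
  qed
  also have "\<dots> = (\<Sum>i<n. LINT \<omega>|game x0. drift \<Omega> \<psi> (\<lambda>_. 1) i (x0, \<omega>)) + L"
    by (simp add: integrable_drift \<psi>b bounded_borel_const prob_space)
  also have "\<dots> \<le> L"
    using integral_drift_nonpos[OF \<psi>b bounded_borel_const step]
    by (simp add: sum_nonpos)
  finally show ?thesis .
qed

lemma summable_alive:
  "summable (\<lambda>i. LINT \<omega>|game x0. (of_bool (alive \<Omega> i (x0, \<omega>)) :: real))"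
proof -
  obtain \<psi> L where "lyapunov \<psi> L" using lyapunov_exists by blast
  show ?thesis
    by (rule summableI_nonneg_bounded[where x = L]) (simp, rule expected_duration, fact)
qed

text \<open>The probability of never leaving is at most that of still running at time \<open>i\<close>, which tends to 0
  since the expected duration is finite.\<close>

lemma AE_game_ends: "AE \<omega> in game x0. \<exists>n. \<not> alive \<Omega> n (x0, \<omega>)"
proof -
  interpret prob_space "game x0" by (rule prob_space_game)
  let ?a = "\<lambda>i \<omega>. of_bool (alive \<Omega> i (x0, \<omega>)) :: real"
  have int: "integrable (game x0) (?a i)" for i
    using integrable_drift[OF bounded_borel_const bounded_borel_const, of x0 0 1 i]
    by (simp add: drift_0_1)
  have pred [measurable]: "Measurable.pred (game x0) (\<lambda>\<omega>. alive \<Omega> i (x0, \<omega>))" for i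
  proof -
    have "Measurable.pred (game x0) (\<lambda>\<omega>. ?a i \<omega> \<noteq> 0)"
      using borel_measurable_integrable[OF int[of i]] by measurable
    then show ?thesis by (simp cong: measurable_cong)
  qed
  let ?N = "{\<omega> \<in> space (game x0). \<forall>n. alive \<Omega> n (x0, \<omega>)}"
  have N: "?N \<in> sets (game x0)" by measurable
  have "measure (game x0) ?N \<le> (LINT \<omega>|game x0. ?a i \<omega>)" for i
  proof -
    have "measure (game x0) ?N = (LINT \<omega>|game x0. indicator ?N \<omega>)"
      using N by simp
    also have "\<dots> \<le> (LINT \<omega>|game x0. ?a i \<omega>)"
      by (intro integral_mono int integrable_real_indicator N)
        (auto simp: emeasure_finite less_top[symmetric] indicator_def)
    finally show ?thesis .
  qed
  moreover have "(\<lambda>i. LINT \<omega>|game x0. ?a i \<omega>) \<longlonglongrightarrow> 0"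
    by (rule summable_LIMSEQ_zero[OF summable_alive])
  ultimately have "measure (game x0) ?N \<le> 0"
    by (intro LIMSEQ_le_const) auto
  then have "?N \<in> null_sets (game x0)"
    using N measure_nonneg[of "game x0" ?N] by (auto simp: null_sets_def emeasure_eq_measure)
  then show ?thesis by (rule AE_I') auto
qed

lemma bounded_borel_run_cost: "bounded_borel (\<lambda>x. - run_cost x)"
  using run_cost_bounded by (auto simp: bounded_borel_def bounded_iff)

text \<open>With gain \<open>- run_cost\<close> the sum of all drifts of \<open>u\<close> telescopes to the payoff minus \<open>u x0\<close>, because \<open>u\<close>
  equals \<open>g\<close> at the exit position.\<close>

lemma payoff_eq:
  assumes u: "\<And>x. x \<notin> \<Omega> \<Longrightarrow> u x = g x"
  shows "payoff p \<epsilon> \<Omega> f g (x0, \<omega>) = (if \<exists>n. \<not> alive \<Omega> n (x0, \<omega>)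
    then u x0 + (\<Sum>i. drift \<Omega> u (\<lambda>x. - run_cost x) i (x0, \<omega>)) else 0)"
proof (cases "\<exists>n. \<not> alive \<Omega> n (x0, \<omega>)")
  case False
  then have "\<not> (\<exists>n. position n (x0, \<omega>) \<notin> \<Omega>)" by (auto simp: alive_def)
  with False show ?thesis by (simp add: payoff_def)
next
  case True
  then obtain n where n: "\<not> alive \<Omega> n (x0, \<omega>)" by blast
  let ?h = "(x0, \<omega>)"
  let ?\<tau> = "exit_time \<Omega> ?h"
  note exit = exit_time_props[OF n]
  have dead: "\<not> alive \<Omega> i ?h" if "?\<tau> \<le> i" for i
    using that exit(1) by (auto simp: alive_def)
  have "(\<Sum>i. drift \<Omega> u (\<lambda>x. - run_cost x) i ?h) = (\<Sum>i<?\<tau>. drift \<Omega> u (\<lambda>x. - run_cost x) i ?h)"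
    by (rule suminf_finite) (auto simp: drift_def dead)
  also have "\<dots> = u (position ?\<tau> ?h) - u x0 + (\<Sum>i<?\<tau>. - run_cost (position i ?h))"
    unfolding sum_drift using dead by (simp add: position_def)
  also have "(\<Sum>i<?\<tau>. - run_cost (position i ?h)) = - \<epsilon>\<^sup>2 * (\<Sum>i<?\<tau>. J p (f (position i ?h)))"
    unfolding sum_distrib_left
    by (rule sum.cong) (use before_exit_time[of _ \<Omega> ?h] in \<open>auto simp: run_cost_def\<close>)
  finally show ?thesis
    using True exit(1) u by (auto simp: payoff_def)
qed

text \<open>Expectation and sum can be exchanged since the drifts are dominated by multiples of the indicator
  that the game is still running, whose expectations are summable.\<close>

lemma expected_payoff_eq:
  assumes u: "bounded_borel u" "\<And>x. x \<notin> \<Omega> \<Longrightarrow> u x = g x"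
  shows "expected_payoff p \<epsilon> \<Omega> f g S_I S_II x0
      = u x0 + (\<Sum>i. LINT \<omega>|game x0. drift \<Omega> u (\<lambda>x. - run_cost x) i (x0, \<omega>))"
    and "summable (\<lambda>i. LINT \<omega>|game x0. drift \<Omega> u (\<lambda>x. - run_cost x) i (x0, \<omega>))"
proof -
  interpret prob_space "game x0" by (rule prob_space_game)
  let ?D = "\<lambda>i \<omega>. drift \<Omega> u (\<lambda>x. - run_cost x) i (x0, \<omega>)"
  note int = integrable_drift[OF u(1) bounded_borel_run_cost, of x0]
  have inta: "integrable (game x0) (\<lambda>\<omega>. of_bool (alive \<Omega> i (x0, \<omega>)) :: real)" for i
    using integrable_drift[OF bounded_borel_const bounded_borel_const, of x0 0 1 i]
    by (simp add: drift_0_1)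
  obtain B where B: "0 \<le> B" "\<And>n h. \<bar>drift \<Omega> u (\<lambda>x. - run_cost x) n h\<bar> \<le> B * of_bool (alive \<Omega> n h)"
    using drift_bounded[OF u(1) bounded_borel_run_cost] by blast
  have summ_norm: "summable (\<lambda>i. LINT \<omega>|game x0. norm (?D i \<omega>))"
  proof (rule summable_comparison_test)
    show "summable (\<lambda>i. B * (LINT \<omega>|game x0. of_bool (alive \<Omega> i (x0, \<omega>))))"
      by (intro summable_mult summable_alive)
    have "(LINT \<omega>|game x0. norm (?D i \<omega>)) \<le> (LINT \<omega>|game x0. B * of_bool (alive \<Omega> i (x0, \<omega>)))" for i
      using B by (intro integral_mono integrable_norm int integrable_mult_right inta) auto
    then show "\<exists>N. \<forall>i\<ge>N. norm (LINT \<omega>|game x0. norm (?D i \<omega>))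
        \<le> B * (LINT \<omega>|game x0. of_bool (alive \<Omega> i (x0, \<omega>)))"
      by auto
  qed
  have summ_AE: "AE \<omega> in game x0. summable (\<lambda>i. norm (?D i \<omega>))"
    using AE_game_ends
  proof eventually_elim
    case (elim \<omega>)
    then obtain n where "\<not> alive \<Omega> n (x0, \<omega>)" by blast
    then have "norm (?D i \<omega>) = 0" if "i \<ge> n" for i
      using not_alive_mono[OF \<open>\<not> alive \<Omega> n (x0, \<omega>)\<close> that] by (simp add: drift_def)
    then show ?case by (intro summable_finite[of "{..<n}"]) (auto simp: not_less)
  qed
  show "summable (\<lambda>i. LINT \<omega>|game x0. ?D i \<omega>)"
    by (rule summable_integral[OF int summ_AE summ_norm])
  have meas: "(\<lambda>\<omega>. \<Sum>i. ?D i \<omega>) \<in> borel_measurable (game x0)"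
    using int by (intro borel_measurable_suminf) auto
  have pred [measurable]: "Measurable.pred (game x0) (\<lambda>\<omega>. alive \<Omega> i (x0, \<omega>))" for i
  proof -
    have "Measurable.pred (game x0) (\<lambda>\<omega>. (of_bool (alive \<Omega> i (x0, \<omega>)) :: real) \<noteq> 0)"
      using borel_measurable_integrable[OF inta[of i]] by measurable
    then show ?thesis by (simp cong: measurable_cong)
  qed
  have "expected_payoff p \<epsilon> \<Omega> f g S_I S_II x0 = (LINT \<omega>|game x0. u x0 + (\<Sum>i. ?D i \<omega>))"
    unfolding expected_payoff_def
  proof (rule integral_cong_AE)
    have "(\<lambda>\<omega>. payoff p \<epsilon> \<Omega> f g (x0, \<omega>)) = (\<lambda>\<omega>. if \<exists>n. \<not> alive \<Omega> n (x0, \<omega>)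
        then u x0 + (\<Sum>i. ?D i \<omega>) else 0)"
      by (rule ext) (rule payoff_eq[OF u(2)])
    also have "\<dots> \<in> borel_measurable (game x0)" using meas by measurable
    finally show "(\<lambda>\<omega>. payoff p \<epsilon> \<Omega> f g (x0, \<omega>)) \<in> borel_measurable (game x0)" .
    show "(\<lambda>\<omega>. u x0 + (\<Sum>i. ?D i \<omega>)) \<in> borel_measurable (game x0)" using meas by measurable
    show "AE \<omega> in game x0. payoff p \<epsilon> \<Omega> f g (x0, \<omega>) = u x0 + (\<Sum>i. ?D i \<omega>)"
      using AE_game_ends by eventually_elim (simp add: payoff_eq[where u = u, OF u(2)])
  qed
  also have "\<dots> = u x0 + (\<Sum>i. LINT \<omega>|game x0. ?D i \<omega>)"
    using integrable_suminf[OF int summ_AE summ_norm]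
    by (simp add: integral_suminf[OF int summ_AE summ_norm] prob_space)
  finally show "expected_payoff p \<epsilon> \<Omega> f g S_I S_II x0 = u x0 + (\<Sum>i. LINT \<omega>|game x0. ?D i \<omega>)" .
qed

text \<open>An error of at most \<open>\<delta>\<close> per turn adds up to at most \<open>\<delta>\<close> times the expected duration. The factor \<open>s\<close> is
  \<open>1\<close> for upper and \<open>-1\<close> for lower bounds of the payoff.\<close>

lemma expected_payoff_le:
  assumes u: "bounded_borel u" "\<And>x. x \<notin> \<Omega> \<Longrightarrow> u x = g x" and \<psi>: "lyapunov \<psi> L" and "0 \<le> \<delta>"
    and step: "\<And>n h. h \<in> space (history_space n) \<Longrightarrow> position n h \<in> \<Omega> \<Longrightarrow>
      s * ((LINT t|law n h. u (snd (snd t))) - run_cost (position n h) - u (position n h)) \<le> \<delta>"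
  shows "s * (expected_payoff p \<epsilon> \<Omega> f g S_I S_II x0 - u x0) \<le> \<delta> * L"
proof -
  interpret prob_space "game x0" by (rule prob_space_game)
  let ?D = "\<lambda>i \<omega>. drift \<Omega> u (\<lambda>x. - run_cost x) i (x0, \<omega>)"
  let ?a = "\<lambda>i \<omega>. of_bool (alive \<Omega> i (x0, \<omega>)) :: real"
  note intD = integrable_drift[OF u(1) bounded_borel_run_cost, of x0]
  have inta: "integrable (game x0) (?a i)" for i
    using integrable_drift[OF bounded_borel_const bounded_borel_const, of x0 0 1 i]
    by (simp add: drift_0_1)
  \<comment> \<open>the extra gain \<open>- \<delta>\<close> compensates the error of a turn\<close>
  let ?V = "\<lambda>x. s * u x" and ?k = "\<lambda>x. s * (- run_cost x) + (- \<delta>)"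
  have V: "bounded_borel ?V" and k: "bounded_borel ?k"
  proof -
    obtain A where A: "\<And>y. \<bar>u y\<bar> \<le> A" using u by (auto simp: bounded_borel_def bounded_iff)
    obtain C where C: "\<And>y. \<bar>run_cost y\<bar> \<le> C" using run_cost_bounded by auto
    have "\<bar>?V y\<bar> \<le> \<bar>s\<bar> * A" for y using A[of y] by (simp add: abs_mult mult_left_mono)
    then show "bounded_borel ?V"
      using u by (auto simp: bounded_borel_def bounded_iff intro!: exI[of _ "\<bar>s\<bar> * A"])
    have "\<bar>?k y\<bar> \<le> \<bar>s\<bar> * C + \<delta>" for y
    proof -
      have "\<bar>?k y\<bar> \<le> \<bar>s * (- run_cost y)\<bar> + \<bar>- \<delta>\<bar>" by (rule abs_triangle_ineq)
      also have "\<dots> \<le> \<bar>s\<bar> * C + \<delta>"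
        using C[of y] \<open>0 \<le> \<delta>\<close> by (simp add: abs_mult mult_left_mono)
      finally show ?thesis .
    qed
    then show "bounded_borel ?k"
      by (auto simp: bounded_borel_def bounded_iff intro!: exI[of _ "\<bar>s\<bar> * C + \<delta>"])
  qed
  have "s * (LINT \<omega>|game x0. ?D i \<omega>) \<le> \<delta> * (LINT \<omega>|game x0. ?a i \<omega>)" for i
  proof -
    have "drift \<Omega> ?V ?k i h = s * drift \<Omega> u (\<lambda>x. - run_cost x) i h - \<delta> * of_bool (alive \<Omega> i h)" for h
      by (simp add: drift_def algebra_simps)
    then have "s * (LINT \<omega>|game x0. ?D i \<omega>) - \<delta> * (LINT \<omega>|game x0. ?a i \<omega>)
      = (LINT \<omega>|game x0. drift \<Omega> ?V ?k i (x0, \<omega>))"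
      using intD[of i] inta[of i] by simp
    also have "\<dots> \<le> 0"
    proof (rule integral_drift_nonpos[OF V k])
      fix h :: "'a history" assume "h \<in> space (history_space i)" "position i h \<in> \<Omega>"
      from step[OF this]
      show "(LINT t|law i h. s * u (snd (snd t))) + ?k (position i h) \<le> s * u (position i h)"
        by (simp add: algebra_simps)
    qed
    finally show ?thesis by simp
  qed
  then have "(\<Sum>i. s * (LINT \<omega>|game x0. ?D i \<omega>)) \<le> (\<Sum>i. \<delta> * (LINT \<omega>|game x0. ?a i \<omega>))"
    by (intro suminf_le summable_mult summable_alive expected_payoff_eq(2) u) auto
  then have "s * (\<Sum>i. LINT \<omega>|game x0. ?D i \<omega>) \<le> \<delta> * (\<Sum>i. LINT \<omega>|game x0. ?a i \<omega>)"
    using suminf_mult[OF expected_payoff_eq(2)[OF u], of s]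
      suminf_mult[OF summable_alive, of \<delta>] by simp
  also have "\<dots> \<le> \<delta> * L"
    using \<open>0 \<le> \<delta>\<close> expected_duration[OF \<psi>]
    by (intro mult_left_mono suminf_le_const summable_alive) auto
  finally show ?thesis
    using expected_payoff_eq(1)[OF u] by simp
qed

end

section \<open>Near-optimal strategies and the value of the game\<close>

text \<open>If both players have near-optimal strategies for the same number \<open>v\<close>, then \<open>v\<close> is the value. The bound
  on \<open>e\<close> makes the suprema and infima of reals meaningful.\<close>

lemma saddle_value:
  fixes e :: "'i \<Rightarrow> 'j \<Rightarrow> real"
  assumes bound: "\<And>i j. i \<in> I \<Longrightarrow> j \<in> K \<Longrightarrow> \<bar>e i j\<bar> \<le> B"
    and lower: "\<And>\<delta>. 0 < \<delta> \<Longrightarrow> \<exists>i\<in>I. \<forall>j\<in>K. v - \<delta> \<le> e i j"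
    and upper: "\<And>\<delta>. 0 < \<delta> \<Longrightarrow> \<exists>j\<in>K. \<forall>i\<in>I. e i j \<le> v + \<delta>"
  shows "(SUP i\<in>I. INF j\<in>K. e i j) = v" "(INF j\<in>K. SUP i\<in>I. e i j) = v"
proof -
  have ne: "I \<noteq> {}" "K \<noteq> {}" using lower[of 1] upper[of 1] by auto
  have b: "e i j \<le> B" "- B \<le> e i j" if "i \<in> I" "j \<in> K" for i j
    using bound[OF that] by auto
  have bI: "bdd_above ((\<lambda>i. e i j) ` I)" if "j \<in> K" for j
    using b(1)[OF _ that] by (rule bdd_aboveI2)
  have bK: "bdd_below ((\<lambda>j. e i j) ` K)" if "i \<in> I" for i
    using b(2)[OF that] by (rule bdd_belowI2)
  have INF_bounds: "(INF j\<in>K. e i j) \<le> B" if "i \<in> I" for i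
    using ne(2) b(1)[OF that] cINF_lower2[OF bK[OF that]] by blast
  have SUP_bounds: "- B \<le> (SUP i\<in>I. e i j)" if "j \<in> K" for j
    using ne(1) b(2)[OF _ that] cSUP_upper2[OF bI[OF that]] by blast
  have bSI: "bdd_above ((\<lambda>i. INF j\<in>K. e i j) ` I)" using INF_bounds by (rule bdd_aboveI2)
  have bIS: "bdd_below ((\<lambda>j. SUP i\<in>I. e i j) ` K)" using SUP_bounds by (rule bdd_belowI2)
  have SI_le_IS: "(SUP i\<in>I. INF j\<in>K. e i j) \<le> (INF j\<in>K. SUP i\<in>I. e i j)"
  proof (intro cSUP_least ne cINF_greatest)
    fix i j assume ij: "i \<in> I" "j \<in> K"
    have "(INF j\<in>K. e i j) \<le> e i j" using ij by (intro cINF_lower bK)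
    also have "\<dots> \<le> (SUP i\<in>I. e i j)" using ij by (intro cSUP_upper bI)
    finally show "(INF j\<in>K. e i j) \<le> (SUP i\<in>I. e i j)" .
  qed
  have "v \<le> (SUP i\<in>I. INF j\<in>K. e i j)"
  proof (rule field_le_epsilon)
    fix \<delta> :: real assume "0 < \<delta>"
    from lower[OF this] obtain i where i: "i \<in> I" "\<And>j. j \<in> K \<Longrightarrow> v - \<delta> \<le> e i j" by blast
    have "v - \<delta> \<le> (INF j\<in>K. e i j)" by (intro cINF_greatest ne i)
    also have "\<dots> \<le> (SUP i\<in>I. INF j\<in>K. e i j)" by (intro cSUP_upper i bSI)
    finally show "v \<le> (SUP i\<in>I. INF j\<in>K. e i j) + \<delta>" by simp
  qed
  moreover have "(INF j\<in>K. SUP i\<in>I. e i j) \<le> v"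
  proof (rule field_le_epsilon)
    fix \<delta> :: real assume "0 < \<delta>"
    from upper[OF this] obtain j where j: "j \<in> K" "\<And>i. i \<in> I \<Longrightarrow> e i j \<le> v + \<delta>" by blast
    have "(INF j\<in>K. SUP i\<in>I. e i j) \<le> (SUP i\<in>I. e i j)" by (intro cINF_lower j bIS)
    also have "\<dots> \<le> v + \<delta>" by (intro cSUP_least ne j)
    finally show "(INF j\<in>K. SUP i\<in>I. e i j) \<le> v + \<delta>" .
  qed
  ultimately show "(SUP i\<in>I. INF j\<in>K. e i j) = v" "(INF j\<in>K. SUP i\<in>I. e i j) = v"
    using SI_le_IS by auto
qed

context tug_game
begin

definition markov_strategy :: "('a \<Rightarrow> real) \<Rightarrow> ('a \<times> real \<Rightarrow> 'a) \<Rightarrow> 'a strategy" where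
  "markov_strategy s m = \<lparr>const = (\<lambda>n h. s (position n h)),
    heads_move = (\<lambda>n h c. m (position n h, heads_radius c)),
    tug_move = (\<lambda>n h c. m (position n h, tug_radius c))\<rparr>"

text \<open>The data of a near-optimal strategy for the player who wants \<open>w\<close> to be small: \<open>s\<close> picks the constant
  and \<open>m\<close> the next position in a given ball. Player II plays this with \<open>w = u\<close> and Player I
  with \<open>w = - u\<close>.\<close>

definition near_minimizing :: "('a \<Rightarrow> real) \<Rightarrow> real \<Rightarrow> ('a \<Rightarrow> real) \<Rightarrow> ('a \<times> real \<Rightarrow> 'a) \<Rightarrow> bool" where
  "near_minimizing w \<delta> s m \<longleftrightarrow>
    s \<in> borel_measurable borel \<and> m \<in> borel_measurable borel \<and> (\<forall>x. s x \<in> choices) \<and>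
    (\<forall>x. bracket w x (s x) < (INF c\<in>choices. bracket w x c) + \<delta>) \<and>
    (\<forall>x r. 0 < r \<longrightarrow> m (x, r) \<in> ball x r \<and> w (m (x, r)) < (INF y\<in>ball x r. w y) + \<delta>)"

lemma near_minimizing_exists:
  assumes "bounded_borel w" "0 < \<delta>"
  shows "\<exists>s m. near_minimizing w \<delta> s m"
proof -
  have w: "w \<in> borel_measurable borel" "bounded (range w)" using assms by (auto simp: bounded_borel_def)
  obtain s where "s \<in> borel_measurable borel" "\<And>x. s x \<in> choices"
    "\<And>x. bracket w x (s x) < (INF c\<in>choices. bracket w x c) + \<delta>"
    using borel_near_minimizer_bracket[OF w assms(2)] by blast
  moreover obtain m where "m \<in> borel_measurable borel" "\<And>x r. 0 < r \<Longrightarrow> m (x, r) \<in> ball x r"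
    "\<And>x r. 0 < r \<Longrightarrow> w (m (x, r)) < (INF y\<in>ball x r. w y) + \<delta>"
    using borel_near_minimizer_ball[OF bounded_range_bdd(2)[OF w(2)] assms(2)] by blast
  ultimately show ?thesis unfolding near_minimizing_def by blast
qed

lemma admissible_markov_strategy:
  assumes "near_minimizing w \<delta> s m"
  shows "admissible p \<epsilon> \<Omega> picks (markov_strategy s m)"
proof -
  have [measurable]: "s \<in> borel_measurable borel" and
    m: "m \<in> borel_measurable (borel \<Otimes>\<^sub>M borel)"
    using assms by (auto simp: near_minimizing_def borel_prod)
  have "(\<lambda>z. m (position n (fst z), \<rho> (snd z))) \<in> borel_measurable (history_space n \<Otimes>\<^sub>M borel)"
    if [measurable]: "\<rho> \<in> borel_measurable borel" for \<rho> :: "real \<Rightarrow> real" and n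
    by (rule measurable_compose[OF _ m]) measurable
  moreover have "heads_radius \<in> borel_measurable borel" "tug_radius \<in> borel_measurable borel"
    unfolding heads_radius_def[abs_def] tug_radius_def[abs_def] by measurable
  moreover have "(\<lambda>h. s (position n h)) \<in> borel_measurable (history_space n)" for n
    by measurable
  moreover have "m (x, heads_radius c) \<in> ball x (heads_radius c)"
    "m (x, tug_radius c) \<in> ball x (tug_radius c)" if "c \<in> choices" for x c
    using assms heads_radius_pos[OF that] tug_radius_pos[OF that] by (auto simp: near_minimizing_def)
  moreover have "s x \<in> choices" for x using assms by (auto simp: near_minimizing_def)
  ultimately show ?thesis
    unfolding admissible_def markov_strategy_def d[symmetric]
      heads_radius_def[symmetric] tug_radius_def[symmetric]
    by (simp add: case_prod_beta' del: atLeastAtMost_iff mem_ball)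
qed

end

context play
begin

lemma bracket_le_add:
  assumes "0 \<le> \<delta>" "a \<le> (SUP y\<in>ball x (heads_radius c). w y)"
    and "b1 \<le> (SUP y\<in>ball x (tug_radius c). w y)" "b2 \<le> (INF y\<in>ball x (tug_radius c). w y) + \<delta>"
  shows "\<alpha> * a + (1 - \<alpha>) * (\<beta> * (1 / 2 * b1 + 1 / 2 * b2) + (1 - \<beta>) * ball_mean w x (tug_radius c))
    \<le> bracket w x c + \<delta>"
proof -
  have "\<alpha> * a + (1 - \<alpha>) * (\<beta> * (1 / 2 * b1 + 1 / 2 * b2) + (1 - \<beta>) * ball_mean w x (tug_radius c))
    \<le> \<alpha> * (SUP y\<in>ball x (heads_radius c). w y) + (1 - \<alpha>) * (\<beta> * (1 / 2 * (SUP y\<in>ball x (tug_radius c). w y)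
      + 1 / 2 * ((INF y\<in>ball x (tug_radius c). w y) + \<delta>)) + (1 - \<beta>) * ball_mean w x (tug_radius c))"
    using assms alpha_bounds beta_bounds by (intro add_mono mult_left_mono) auto
  also have "\<dots> = bracket w x c + ((1 - \<alpha>) * \<beta> * (1 / 2)) * \<delta>"
    by (simp add: bracket_def field_simps)
  also have "((1 - \<alpha>) * \<beta> * (1 / 2)) * \<delta> \<le> 1 * \<delta>"
    using assms(1) alpha_bounds beta_bounds mult_le_one[of "1 - \<alpha>" \<beta>]
    by (intro mult_right_mono) auto
  finally show ?thesis by simp
qed

lemma le_bracket_uminus_add:
  assumes "0 \<le> \<delta>" "a \<le> (INF y\<in>ball x (heads_radius c). w y) + \<delta>"
    and "b1 \<le> (SUP y\<in>ball x (tug_radius c). w y)" "b2 \<le> (INF y\<in>ball x (tug_radius c). w y) + \<delta>"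
  shows "\<alpha> * a + (1 - \<alpha>) * (\<beta> * (1 / 2 * b1 + 1 / 2 * b2) + (1 - \<beta>) * ball_mean w x (tug_radius c))
    \<le> - bracket (\<lambda>y. - w y) x c + \<delta>"
proof -
  have "\<alpha> * a + (1 - \<alpha>) * (\<beta> * (1 / 2 * b1 + 1 / 2 * b2) + (1 - \<beta>) * ball_mean w x (tug_radius c))
    \<le> \<alpha> * ((INF y\<in>ball x (heads_radius c). w y) + \<delta>)
      + (1 - \<alpha>) * (\<beta> * (1 / 2 * ((SUP y\<in>ball x (tug_radius c). w y) + \<delta>)
      + 1 / 2 * ((INF y\<in>ball x (tug_radius c). w y) + \<delta>)) + (1 - \<beta>) * (ball_mean w x (tug_radius c) + \<delta>))"
    using assms alpha_bounds beta_bounds by (intro add_mono mult_left_mono) auto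
  also have "\<dots> = - bracket (\<lambda>y. - w y) x c + \<delta>"
    by (simp add: bracket_uminus field_simps)
  finally show ?thesis .
qed

text \<open>The expectation \<open>E\<close> of \<open>w\<close> after a turn in which the minimizer of \<open>w\<close> follows \<open>s\<close> and \<open>m\<close>: \<open>b1\<close> is the move of
  the opponent and \<open>b2\<close> that of the minimizer in the tug-of-war round. The two cases are that the
  minimizer picks the constant, so that the opponent moves on heads, and the reverse.\<close>

lemma near_minimizing_step:
  assumes w: "bounded_borel w" and nm: "near_minimizing w \<delta> s m" and \<delta>: "0 < \<delta>"
    and h: "h \<in> space (history_space n)" "position n h \<in> \<Omega>"
    and b1: "b1 \<in> ball (position n h) (tug_radius (chosen n h))"
    and b2: "b2 = m (position n h, tug_radius (chosen n h))"
  defines "E \<equiv> \<alpha> * w (on_heads n h) + (1 - \<alpha>) * (\<beta> * (1 / 2 * w b1 + 1 / 2 * w b2)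
      + (1 - \<beta>) * ball_mean w (position n h) (tug_radius (chosen n h)))"
  shows "chosen n h = s (position n h) \<Longrightarrow> E \<le> (INF c\<in>choices. bracket w (position n h) c) + 2 * \<delta>"
    and "on_heads n h = m (position n h, heads_radius (chosen n h)) \<Longrightarrow>
      E \<le> - (INF c\<in>choices. bracket (\<lambda>y. - w y) (position n h) c) + 2 * \<delta>"
proof -
  note c = chosen_in_choices[OF h]
  let ?x = "position n h" and ?c = "chosen n h"
  have bdd: "bdd_above (w ` S)" "bdd_below (w ` S)" for S
    using w bounded_range_bdd[of w S] by (auto simp: bounded_borel_def)
  have sup1: "w b1 \<le> (SUP y\<in>ball ?x (tug_radius ?c). w y)" using b1 by (intro cSUP_upper bdd)
  have inf2: "w b2 \<le> (INF y\<in>ball ?x (tug_radius ?c). w y) + \<delta>"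
    unfolding b2 using nm tug_radius_pos[OF c] by (auto simp: near_minimizing_def intro: less_imp_le)
  show "E \<le> (INF c\<in>choices. bracket w ?x c) + 2 * \<delta>" if "?c = s ?x"
  proof -
    have "w (on_heads n h) \<le> (SUP y\<in>ball ?x (heads_radius ?c). w y)"
      using move_in_ball(1)[OF h] by (intro cSUP_upper bdd)
    then have "E \<le> bracket w ?x ?c + \<delta>"
      unfolding E_def using \<delta> by (intro bracket_le_add sup1 inf2) auto
    also have "bracket w ?x ?c < (INF c\<in>choices. bracket w ?x c) + \<delta>"
      unfolding that using nm by (auto simp: near_minimizing_def)
    finally show ?thesis by simp
  qed
  show "E \<le> - (INF c\<in>choices. bracket (\<lambda>y. - w y) ?x c) + 2 * \<delta>" if "on_heads n h = m (?x, heads_radius ?c)"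
  proof -
    have "w (on_heads n h) \<le> (INF y\<in>ball ?x (heads_radius ?c). w y) + \<delta>"
      unfolding that using nm heads_radius_pos[OF c] by (auto simp: near_minimizing_def intro: less_imp_le)
    then have "E \<le> - bracket (\<lambda>y. - w y) ?x ?c + \<delta>"
      unfolding E_def using \<delta> by (intro le_bracket_uminus_add sup1 inf2) auto
    moreover have "(INF c\<in>choices. bracket (\<lambda>y. - w y) ?x c) \<le> bracket (\<lambda>y. - w y) ?x ?c"
      using bounded_borel_uminus[OF w] c by (intro cINF_lower bracket_bdd_below) (auto simp: bounded_borel_def)
    ultimately show ?thesis using \<delta> by simp
  qed
qed

lemma fixed_point_on_Omega:
  assumes "bounded_borel u" "dpp u = u" "x \<in> \<Omega>"
  shows "0 \<le> f x \<Longrightarrow> (INF c\<in>choices. bracket u x c) = u x + run_cost x"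
    and "\<not> 0 \<le> f x \<Longrightarrow> (INF c\<in>choices. bracket (\<lambda>y. - u y) x c) = - (u x + run_cost x)"
  using fun_cong[OF assms(2), of x, unfolded dpp_def A_op_def] assms(1,3)
  by (auto simp: A_plus_eq A_minus_eq bounded_borel_def)

lemma step_II:
  assumes u: "bounded_borel u" "dpp u = u" and nm: "near_minimizing u \<delta> s m" and \<delta>: "0 < \<delta>"
    and S: "S_II = markov_strategy s m"
    and h: "h \<in> space (history_space n)" "position n h \<in> \<Omega>"
  shows "(LINT t|law n h. u (snd (snd t))) - run_cost (position n h) - u (position n h) \<le> 2 * \<delta>"
proof -
  have b2: "tug_move S_II n h (chosen n h) = m (position n h, tug_radius (chosen n h))"
    by (simp add: S markov_strategy_def)
  note step = near_minimizing_step[OF u(1) nm \<delta> h move_in_ball(2)[OF h] b2]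
  show ?thesis
  proof (cases "0 \<le> f (position n h)")
    case True
    moreover have "const S_II n h = s (position n h)" by (simp add: S markov_strategy_def)
    ultimately have "chosen n h = s (position n h)" by (simp add: chosen_def)
    from step(1)[OF this] show ?thesis
      unfolding integral_law[OF h u(1)] fixed_point_on_Omega(1)[OF u h(2) True] by simp
  next
    case False
    moreover have "heads_move S_II n h c = m (position n h, heads_radius c)" for c
      by (simp add: S markov_strategy_def)
    ultimately have "on_heads n h = m (position n h, heads_radius (chosen n h))"
      by (simp add: on_heads_def)
    from step(2)[OF this] show ?thesis
      unfolding integral_law[OF h u(1)] fixed_point_on_Omega(2)[OF u h(2) False] by simp
  qed
qed

lemma step_I:
  assumes u: "bounded_borel u" "dpp u = u" and nm: "near_minimizing (\<lambda>y. - u y) \<delta> s m" and \<delta>: "0 < \<delta>"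
    and S: "S_I = markov_strategy s m"
    and h: "h \<in> space (history_space n)" "position n h \<in> \<Omega>"
  shows "(- 1) * ((LINT t|law n h. u (snd (snd t))) - run_cost (position n h) - u (position n h)) \<le> 2 * \<delta>"
proof -
  have b2: "tug_move S_I n h (chosen n h) = m (position n h, tug_radius (chosen n h))"
    by (simp add: S markov_strategy_def)
  note step = near_minimizing_step[OF bounded_borel_uminus[OF u(1)] nm \<delta> h move_in_ball(3)[OF h] b2]
  have int: "- (LINT t|law n h. u (snd (snd t))) = \<alpha> * - u (on_heads n h)
    + (1 - \<alpha>) * (\<beta> * (1 / 2 * - u (tug_move S_II n h (chosen n h)) + 1 / 2 * - u (tug_move S_I n h (chosen n h)))
      + (1 - \<beta>) * ball_mean (\<lambda>y. - u y) (position n h) (tug_radius (chosen n h)))"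
    unfolding integral_law[OF h u(1)] ball_mean_uminus by (simp add: algebra_simps)
  show ?thesis
  proof (cases "0 \<le> f (position n h)")
    case False
    moreover have "const S_I n h = s (position n h)" by (simp add: S markov_strategy_def)
    ultimately have "chosen n h = s (position n h)" by (simp add: chosen_def)
    from step(1)[OF this] show ?thesis
      unfolding int[symmetric] fixed_point_on_Omega(2)[OF u h(2) False] by simp
  next
    case True
    moreover have "heads_move S_I n h c = m (position n h, heads_radius c)" for c
      by (simp add: S markov_strategy_def)
    ultimately have "on_heads n h = m (position n h, heads_radius (chosen n h))"
      by (simp add: on_heads_def)
    from step(2)[OF this] show ?thesis
      unfolding int[symmetric] minus_minus fixed_point_on_Omega(1)[OF u h(2) True] by simp
  qed
qed

text \<open>Any strategies satisfy the one-step condition with the crude error \<open>2 B + C\<close>, so the payoffs are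
  bounded uniformly.\<close>

lemma expected_payoff_bound:
  assumes u: "bounded_borel u" "\<And>x. x \<notin> \<Omega> \<Longrightarrow> u x = g x" and \<psi>: "lyapunov \<psi> L"
    and B: "\<And>y. \<bar>u y\<bar> \<le> B" and C: "\<And>y. \<bar>run_cost y\<bar> \<le> C"
  shows "\<bar>expected_payoff p \<epsilon> \<Omega> f g S_I S_II x0\<bar> \<le> B + (2 * B + C) * L"
proof -
  have BC: "0 \<le> B" "0 \<le> C" using B[of undefined] C[of undefined] by auto
  have step: "\<bar>(LINT t|law n h. u (snd (snd t))) - run_cost (position n h) - u (position n h)\<bar> \<le> 2 * B + C"
    if h: "h \<in> space (history_space n)" "position n h \<in> \<Omega>" for n h
  proof -
    interpret law: prob_space "law n h" using h(1) by (rule prob_space_law)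
    have "u \<in> borel_measurable borel" using u by (simp add: bounded_borel_def)
    then have m: "(\<lambda>t. u (snd (snd t))) \<in> borel_measurable (law n h)"
      using measurable_compose[OF measurable_turn_position, of u]
      by (simp add: measurable_cong_sets[OF sets_kernel[OF measurable_law h(1)] refl])
    have "\<bar>LINT t|law n h. u (snd (snd t))\<bar> \<le> (LINT t|law n h. B)"
      by (intro integral_abs_bound[THEN order_trans] integral_mono integrable_abs
          law.integrable_const_bound[where B = B] m) (use B BC in auto)
    then have "\<bar>LINT t|law n h. u (snd (snd t))\<bar> \<le> B" by (simp add: law.prob_space)
    then show ?thesis using B[of "position n h"] C[of "position n h"] by linarith
  qed
  define K where "K = (2 * B + C) * L"
  have "1 * (expected_payoff p \<epsilon> \<Omega> f g S_I S_II x0 - u x0) \<le> K"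
    unfolding K_def using step BC by (intro expected_payoff_le[OF u \<psi>]) (auto simp: abs_le_iff)
  moreover have "(- 1) * (expected_payoff p \<epsilon> \<Omega> f g S_I S_II x0 - u x0) \<le> K"
    unfolding K_def using step BC by (intro expected_payoff_le[OF u \<psi>]) (auto simp: abs_le_iff)
  ultimately have "\<bar>expected_payoff p \<epsilon> \<Omega> f g S_I S_II x0\<bar> \<le> B + K"
    using B[of x0] by (simp add: abs_le_iff)
  then show ?thesis by (simp add: K_def)
qed

end

context tug_game
begin

lemma playI:
  "S_I \<in> strategies_I p \<epsilon> \<Omega> f \<Longrightarrow> S_II \<in> strategies_II p \<epsilon> \<Omega> f \<Longrightarrow> play p \<epsilon> d \<Omega> f g S_I S_II"
  by (intro play.intro play_axioms.intro tug_game_axioms)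

text \<open>The accuracy \<open>\<eta>\<close> of the near-optimal strategies is chosen such that the error of at most \<open>2 \<eta>\<close> per
  turn accumulates to \<open>\<delta>\<close> over an expected duration of at most \<open>L\<close>.\<close>

lemma solution_eq_value:
  assumes "bounded_borel_dpp_solution p \<epsilon> \<Omega> f g u"
  shows "value_I p \<epsilon> \<Omega> f g x0 = u x0" "value_II p \<epsilon> \<Omega> f g x0 = u x0"
proof -
  have u: "bounded_borel u" "dpp u = u" using assms by (auto simp: solution_iff_fixed_point)
  have ug: "u x = g x" if "x \<notin> \<Omega>" for x using assms that by (simp add: bounded_borel_dpp_solution_def)
  obtain \<psi> L where \<psi>: "lyapunov \<psi> L" using lyapunov_exists by blast
  have L: "1 \<le> L" using \<psi> by (simp add: lyapunov_def)
  obtain B where B: "\<And>y. \<bar>u y\<bar> \<le> B" using u by (auto simp: bounded_borel_def bounded_iff)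
  obtain C where C: "\<And>y. \<bar>run_cost y\<bar> \<le> C" using run_cost_bounded by blast
  let ?e = "\<lambda>S_I S_II. expected_payoff p \<epsilon> \<Omega> f g S_I S_II x0"
  have bound: "\<bar>?e S_I S_II\<bar> \<le> B + (2 * B + C) * L"
    if "S_I \<in> strategies_I p \<epsilon> \<Omega> f" "S_II \<in> strategies_II p \<epsilon> \<Omega> f" for S_I S_II
    by (rule play.expected_payoff_bound[OF playI[OF that] u(1) ug \<psi> B C])
  have upper: "\<exists>S_II\<in>strategies_II p \<epsilon> \<Omega> f. \<forall>S_I\<in>strategies_I p \<epsilon> \<Omega> f. ?e S_I S_II \<le> u x0 + \<delta>"
    if "0 < \<delta>" for \<delta>
  proof -
    define \<eta> where "\<eta> = \<delta> / (2 * L)"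
    have \<eta>: "0 < \<eta>" "2 * \<eta> * L = \<delta>" using that L by (auto simp: \<eta>_def)
    obtain s m where nm: "near_minimizing u \<eta> s m" using near_minimizing_exists[OF u(1) \<eta>(1)] by blast
    have S: "markov_strategy s m \<in> strategies_II p \<epsilon> \<Omega> f"
      using admissible_markov_strategy[OF nm] by (simp add: strategies_II_def)
    have "?e S_I (markov_strategy s m) \<le> u x0 + \<delta>" if S_I: "S_I \<in> strategies_I p \<epsilon> \<Omega> f" for S_I
    proof -
      interpret play p \<epsilon> d \<Omega> f g S_I "markov_strategy s m" by (rule playI[OF S_I S])
      have "1 * (?e S_I (markov_strategy s m) - u x0) \<le> 2 * \<eta> * L"
        using step_II[OF u nm \<eta>(1) refl] \<eta>(1) by (intro expected_payoff_le[OF u(1) ug \<psi>]) auto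
      then show ?thesis using \<eta>(2) by simp
    qed
    with S show ?thesis by blast
  qed
  have lower: "\<exists>S_I\<in>strategies_I p \<epsilon> \<Omega> f. \<forall>S_II\<in>strategies_II p \<epsilon> \<Omega> f. u x0 - \<delta> \<le> ?e S_I S_II"
    if "0 < \<delta>" for \<delta>
  proof -
    define \<eta> where "\<eta> = \<delta> / (2 * L)"
    have \<eta>: "0 < \<eta>" "2 * \<eta> * L = \<delta>" using that L by (auto simp: \<eta>_def)
    obtain s m where nm: "near_minimizing (\<lambda>y. - u y) \<eta> s m"
      using near_minimizing_exists[OF bounded_borel_uminus[OF u(1)] \<eta>(1)] by blast
    have S: "markov_strategy s m \<in> strategies_I p \<epsilon> \<Omega> f"
      using admissible_markov_strategy[OF nm] by (simp add: strategies_I_def)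
    have "u x0 - \<delta> \<le> ?e (markov_strategy s m) S_II" if S_II: "S_II \<in> strategies_II p \<epsilon> \<Omega> f" for S_II
    proof -
      interpret play p \<epsilon> d \<Omega> f g "markov_strategy s m" S_II by (rule playI[OF S S_II])
      have "(- 1) * (?e (markov_strategy s m) S_II - u x0) \<le> 2 * \<eta> * L"
        using step_I[OF u nm \<eta>(1) refl] \<eta>(1) by (intro expected_payoff_le[OF u(1) ug \<psi>]) auto
      then show ?thesis using \<eta>(2) by simp
    qed
    with S show ?thesis by blast
  qed
  show "value_I p \<epsilon> \<Omega> f g x0 = u x0"
    unfolding value_I_def by (rule saddle_value(1)[OF bound lower upper])
  show "value_II p \<epsilon> \<Omega> f g x0 = u x0"
    unfolding value_II_def by (rule saddle_value(2)[OF bound lower upper])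
qed

end

theorem theorem2p7:
  fixes \<Omega> :: "'a::euclidean_space set" and f g :: "'a \<Rightarrow> real" and p \<epsilon> :: real
  assumes "p > 2"
    and "open \<Omega>" and "bounded \<Omega>" and "uniform_exterior_ball \<Omega>"
    and "continuous_on (closure \<Omega>) f"
    and "continuous_on (- \<Omega>) g" and "bounded (g ` (- \<Omega>))"
    and "0 < \<epsilon>" and "\<epsilon> < 1"
  shows "\<exists>u. bounded_borel_dpp_solution p \<epsilon> \<Omega> f g u \<and>
    (\<forall>v. bounded_borel_dpp_solution p \<epsilon> \<Omega> f g v \<longrightarrow> v = u) \<and>
    (\<forall>x. u x = value_I p \<epsilon> \<Omega> f g x \<and> u x = value_II p \<epsilon> \<Omega> f g x)"
proof -
  interpret tug_game p \<epsilon> "DIM('a)" \<Omega> f g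
    by (rule tug_game.intro) (use assms in simp_all)
  obtain u where u: "bounded_borel_dpp_solution p \<epsilon> \<Omega> f g u"
    using solution_exists by blast
  show ?thesis
  proof (intro exI conjI allI impI)
    show "bounded_borel_dpp_solution p \<epsilon> \<Omega> f g u" by (rule u)
    show "v = u" if "bounded_borel_dpp_solution p \<epsilon> \<Omega> f g v" for v
      by (rule ext) (rule trans[OF solution_eq_value(1)[OF that, symmetric] solution_eq_value(1)[OF u]])
    show "u x = value_I p \<epsilon> \<Omega> f g x" "u x = value_II p \<epsilon> \<Omega> f g x" for x
      by (rule solution_eq_value[OF u, symmetric])+
  qed
qed

end
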